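(* Let $M:=\{(z,w)\in\mathbb{C}^2 : |z|=|w|\}\setminus\{(0,0)\}$. Then a totally real disc $K$ contained in $M$ is polynomially convex if and only if $\widehat{K}\cap\{(z,w)\in\mathbb{C}^2 : zw=0\}=\emptyset$.
   Context: For a compact $K\subset\mathbb{C}^n$, $\widehat{K}:=\{z\in\mathbb{C}^n : |p(z)|\le \sup_K|p| \text{ for all holomorphic polynomials } p\}$, and $K$ is polynomially convex if $\widehat{K}=K$. A totally real disc is a compact subset of a $C^1$-smooth submanifold $N$ of $\mathbb{C}^2$ with $T_pN\cap iT_pN=\{0\}$ for all $p\in N$, which is diffeomorphic to the closed unit disc in the plane. *)

theory Defs
  imports "HOL-Analysis.Analysis"
begin

definition imul2 :: "complex \<times> complex \<Rightarrow> complex \<times> complex" where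
  "imul2 v = (\<i> * fst v, \<i> * snd v)"

definition hol_poly2 :: "(complex \<times> complex \<Rightarrow> complex) \<Rightarrow> bool" where
  "hol_poly2 f \<longleftrightarrow> (\<exists>(n::nat) (c::nat \<Rightarrow> nat \<Rightarrow> complex).
      f = (\<lambda>(z, w). \<Sum>i\<le>n. \<Sum>j\<le>n. c i j * z ^ i * w ^ j))"

definition poly_hull :: "(complex \<times> complex) set \<Rightarrow> (complex \<times> complex) set" where
  "poly_hull K = {x. \<forall>f. hol_poly2 f \<longrightarrow> norm (f x) \<le> (SUP y\<in>K. norm (f y))}"

definition poly_convex :: "(complex \<times> complex) set \<Rightarrow> bool" where
  "poly_convex K \<longleftrightarrow> poly_hull K = K"

definition chart2 ::
  "(complex \<times> complex) set \<Rightarrow> (complex \<times> complex) set \<Rightarrow> (real^2) set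
     \<Rightarrow> (real^2 \<Rightarrow> complex \<times> complex) \<Rightarrow> (real^2 \<Rightarrow> ((real^2) \<Rightarrow>\<^sub>L (complex \<times> complex))) \<Rightarrow> bool" where
  "chart2 N V W \<psi> D \<longleftrightarrow> open V \<and> open W
     \<and> (\<forall>x\<in>W. (\<psi> has_derivative blinfun_apply (D x)) (at x))
     \<and> continuous_on W D
     \<and> (\<forall>x\<in>W. inj (blinfun_apply (D x)))
     \<and> (\<exists>\<psi>'. homeomorphism W (N \<inter> V) \<psi> \<psi>')"

definition c1_submanifold2 :: "(complex \<times> complex) set \<Rightarrow> bool" where
  "c1_submanifold2 N \<longleftrightarrow> (\<forall>p\<in>N. \<exists>V W \<psi> D. p \<in> V \<and> chart2 N V W \<psi> D)"

definition tangent_space :: "(complex \<times> complex) set \<Rightarrow> complex \<times> complex \<Rightarrow> (complex \<times> complex) set" where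
  "tangent_space N p = {v. \<exists>V W \<psi> D x. chart2 N V W \<psi> D \<and> x \<in> W \<and> \<psi> x = p
                            \<and> v \<in> range (blinfun_apply (D x))}"

definition totally_real_submanifold :: "(complex \<times> complex) set \<Rightarrow> bool" where
  "totally_real_submanifold N \<longleftrightarrow> c1_submanifold2 N \<and>
     (\<forall>p\<in>N. \<forall>v. v \<in> tangent_space N p \<and> v \<in> imul2 ` tangent_space N p \<longrightarrow> v = 0)"

text \<open>Totally real disc: a compact subset K of a totally real C^1 submanifold N which is
  C^1-diffeomorphic to the closed unit disc, i.e. K is the image of the closed unit disc under
  a C^1 map phi defined on an open neighbourhood U of the disc, with values in N, injective on
  the disc and with injective derivative (an immersion).\<close>
definition totally_real_disc :: "(complex \<times> complex) set \<Rightarrow> bool" where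
  "totally_real_disc K \<longleftrightarrow> (\<exists>N U (\<phi>::real^2 \<Rightarrow> complex \<times> complex) D.
      totally_real_submanifold N \<and> K \<subseteq> N \<and>
      open U \<and> cball 0 1 \<subseteq> U \<and> \<phi> ` U \<subseteq> N \<and>
      (\<forall>x\<in>U. (\<phi> has_derivative blinfun_apply (D x)) (at x)) \<and> continuous_on U D \<and>
      (\<forall>x\<in>U. inj (blinfun_apply (D x))) \<and>
      inj_on \<phi> (cball 0 1) \<and> K = \<phi> ` cball 0 1)"

definition Mcone :: "(complex \<times> complex) set" where
  "Mcone = {(z, w). norm z = norm w} - {(0, 0)}"

end

theory Submission
  imports Defs
begin

text \<open>Let \<open>X\<close> be the hull of \<open>K\<close> and suppose that \<open>X\<close> misses \<open>z w = 0\<close>. Then \<open>z\<close> and \<open>w\<close> are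
  invertible in the algebra of uniform limits of polynomials on \<open>X\<close>, so \<open>z/w\<close> and \<open>w/z\<close> are bounded
  by 1 on \<open>X\<close>, and \<open>X\<close> lies in the Levi-flat hypersurface \<open>M\<close>. Peak functions in \<open>z/w\<close> show that
  \<open>X\<close> is obtained by taking the hull of \<open>K\<close> in each leaf \<open>z = t w\<close> separately. These leafwise hulls
  are trivial: \<open>K\<close> being totally real, a lift of \<open>arg (z/w)\<close> to the disc has no critical points, hence
  its level sets do not separate the plane, and nonseparation is a topological invariant of
  plane compacta.\<close>

section \<open>Polynomials in two variables\<close>

text \<open>By Gelfand theory the hull is the character space of the algebra, which would make the
  invertibility of \<open>z\<close> and \<open>w\<close> immediate; elementary means replace it
  here. A point \<open>(l, 0)\<close> off the hull is excluded by a polynomial, which yields an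
  identity \<open>a * w + b * (z - l) = 1\<close>. Having one for every \<open>l\<close> forces
  \<open>w\<close> to be a unit, since otherwise \<open>z\<close> would have empty spectrum in the
  quotient by \<open>w\<close>. The obstacle on the leaves is that \<open>K\<close> may meet a leaf
  in a set with many components, lying on several levels of the lifted argument that differ by
  multiples of 2 pi. Separation of the plane can be tested on one component, and there the lift is
  constant. A bounded complementary component of such a set in the disc would contain a local
  extremum of the lift, which total reality excludes. Since \<open>w\<close> is injective on a leaf,
  the conclusion transfers to the \<open>w\<close>-plane, where nonseparation lets the pole of
  \<open>1/(w - w0)\<close> be pushed to infinity as in Runge's theorem.\<close>

lemma hol_poly2_const: "hol_poly2 (\<lambda>_. c)"
  unfolding hol_poly2_def
  by (intro exI[of _ 0] exI[of _ "\<lambda>_ _. c"]) (auto simp: fun_eq_iff)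

lemma hol_poly2_add:
  assumes "hol_poly2 f" "hol_poly2 g"
  shows "hol_poly2 (\<lambda>x. f x + g x)"
proof -
  obtain n c where f: "f = (\<lambda>(z, w). \<Sum>i\<le>n. \<Sum>j\<le>n. c i j * z ^ i * w ^ j)"
    using assms(1) unfolding hol_poly2_def by blast
  obtain m d where g: "g = (\<lambda>(z, w). \<Sum>i\<le>m. \<Sum>j\<le>m. d i j * z ^ i * w ^ j)"
    using assms(2) unfolding hol_poly2_def by blast
  \<comment> \<open>Coefficients outside the old square are set to 0, so that both sums can run up
    to a common degree bound.\<close>
  have pad: "(\<Sum>i\<le>n. \<Sum>j\<le>n. c i j * z ^ i * w ^ j)
      = (\<Sum>i\<le>N. \<Sum>j\<le>N. (if i \<le> n \<and> j \<le> n then c i j else 0) * z ^ i * w ^ j)"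
    if "n \<le> N" for n N :: nat and c :: "nat \<Rightarrow> nat \<Rightarrow> complex" and z w :: complex
  proof -
    have "(\<Sum>(i,j)\<in>{..n}\<times>{..n}. c i j * z ^ i * w ^ j)
      = (\<Sum>(i,j)\<in>{..N}\<times>{..N}. (if i \<le> n \<and> j \<le> n then c i j else 0) * z ^ i * w ^ j)"
      using that by (intro sum.mono_neutral_cong_left) (auto split: if_splits)
    then show ?thesis by (simp add: sum.cartesian_product)
  qed
  define N where "N = max n m"
  define e where
    "e i j = (if i \<le> n \<and> j \<le> n then c i j else 0) + (if i \<le> m \<and> j \<le> m then d i j else 0)" for i j
  have "(\<lambda>x. f x + g x) = (\<lambda>(z, w). \<Sum>i\<le>N. \<Sum>j\<le>N. e i j * z ^ i * w ^ j)"
    unfolding e_def f g using pad[of n N c] pad[of m N d]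
    by (auto simp: fun_eq_iff N_def sum.distrib ring_distribs simp del: if_distrib)
  then show ?thesis unfolding hol_poly2_def by blast
qed

lemma hol_poly2_sum:
  assumes "\<And>i. i \<in> I \<Longrightarrow> hol_poly2 (f i)"
  shows "hol_poly2 (\<lambda>x. \<Sum>i\<in>I. f i x)"
proof (cases "finite I")
  case True
  then show ?thesis using assms
    by (induction I rule: finite_induct) (auto intro: hol_poly2_const hol_poly2_add)
qed (simp add: hol_poly2_const)

lemma hol_poly2_monom: "hol_poly2 (\<lambda>x. c * fst x ^ i * snd x ^ j)"
proof -
  define n where "n = max i j"
  have "(\<Sum>i'\<le>n. \<Sum>j'\<le>n. (if i' = i \<and> j' = j then c else 0) * z ^ i' * w ^ j') = c * z ^ i * w ^ j"
    for z w :: complex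
  proof -
    have "(\<Sum>(i',j')\<in>{..n}\<times>{..n}. (if i' = i \<and> j' = j then c else 0) * z ^ i' * w ^ j')
       = (\<Sum>(i',j')\<in>{(i,j)}. c * z ^ i' * w ^ j')"
      by (intro sum.mono_neutral_cong_right) (auto simp: n_def split: if_splits)
    then show ?thesis by (simp add: sum.cartesian_product)
  qed
  then show ?thesis unfolding hol_poly2_def
    by (intro exI[of _ n] exI[of _ "\<lambda>i' j'. if i' = i \<and> j' = j then c else 0"])
       (auto simp: fun_eq_iff)
qed

lemma hol_poly2_fst: "hol_poly2 fst" and hol_poly2_snd: "hol_poly2 snd"
  using hol_poly2_monom[of 1 1 0] hol_poly2_monom[of 1 0 1] by simp_all

lemma hol_poly2_mult:
  assumes "hol_poly2 f" "hol_poly2 g"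
  shows "hol_poly2 (\<lambda>x. f x * g x)"
proof -
  obtain n c where f: "f = (\<lambda>(z, w). \<Sum>i\<le>n. \<Sum>j\<le>n. c i j * z ^ i * w ^ j)"
    using assms(1) unfolding hol_poly2_def by blast
  obtain m d where g: "g = (\<lambda>(z, w). \<Sum>i\<le>m. \<Sum>j\<le>m. d i j * z ^ i * w ^ j)"
    using assms(2) unfolding hol_poly2_def by blast
  have monom: "hol_poly2 (\<lambda>x. c i j * fst x ^ i * snd x ^ j * g x)" for i j
  proof -
    have "(\<lambda>x. c i j * fst x ^ i * snd x ^ j * g x)
        = (\<lambda>x. \<Sum>k\<le>m. \<Sum>l\<le>m. (c i j * d k l) * fst x ^ (i + k) * snd x ^ (j + l))"
      unfolding g by (simp add: fun_eq_iff sum_distrib_left power_add mult_ac)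
    then show ?thesis
      by (simp only:) (intro hol_poly2_sum hol_poly2_monom)
  qed
  have "(\<lambda>x. f x * g x) = (\<lambda>x. \<Sum>i\<le>n. \<Sum>j\<le>n. c i j * fst x ^ i * snd x ^ j * g x)"
    unfolding f by (simp add: fun_eq_iff sum_distrib_right)
  then show ?thesis
    by (simp only:) (intro hol_poly2_sum monom)
qed

lemma hol_poly2_power: "hol_poly2 f \<Longrightarrow> hol_poly2 (\<lambda>x. f x ^ n)"
  by (induction n) (auto intro: hol_poly2_const hol_poly2_mult)

lemma hol_poly2_diff: "hol_poly2 f \<Longrightarrow> hol_poly2 g \<Longrightarrow> hol_poly2 (\<lambda>x. f x - g x)"
  using hol_poly2_add[of f, OF _ hol_poly2_mult[OF hol_poly2_const[of "-1"]], of g] by simp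

lemma hol_poly2_induct [consumes 1, case_names const fst snd add mult]:
  assumes "hol_poly2 f"
    and const: "\<And>c. P (\<lambda>_. c)" and fst: "P fst" and snd: "P snd"
    and add: "\<And>f g. hol_poly2 f \<Longrightarrow> hol_poly2 g \<Longrightarrow> P f \<Longrightarrow> P g \<Longrightarrow> P (\<lambda>x. f x + g x)"
    and mult: "\<And>f g. hol_poly2 f \<Longrightarrow> hol_poly2 g \<Longrightarrow> P f \<Longrightarrow> P g \<Longrightarrow> P (\<lambda>x. f x * g x)"
  shows "P f"
proof -
  have sum: "P (\<lambda>x. \<Sum>i\<in>I. f i x)"
    if "\<And>i. i \<in> I \<Longrightarrow> P (f i) \<and> hol_poly2 (f i)" "finite I"
    for I :: "nat set" and f
    using that(2,1)
  proof (induction I rule: finite_induct)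
    case (insert i I)
    then have "P (f i)" "hol_poly2 (f i)" "P (\<lambda>x. \<Sum>i\<in>I. f i x)" "hol_poly2 (\<lambda>x. \<Sum>i\<in>I. f i x)"
      by (auto intro: hol_poly2_sum)
    then show ?case unfolding sum.insert[OF insert.hyps] by (intro add)
  qed (simp add: const)
  have pow: "P (\<lambda>x. f x ^ n)" if "P f" "hol_poly2 f" for f n
    using that by (induction n) (auto intro: const mult hol_poly2_power)
  have "P (\<lambda>x. c * fst x ^ i * snd x ^ j)" for c i j
    by (intro mult const pow fst snd hol_poly2_const hol_poly2_mult hol_poly2_power hol_poly2_fst hol_poly2_snd)
  then have mon: "P (\<lambda>x. \<Sum>i\<le>n. \<Sum>j\<le>n. c i j * fst x ^ i * snd x ^ j)" for c and n :: nat
    by (intro sum conjI hol_poly2_sum hol_poly2_monom) auto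
  obtain n c where "f = (\<lambda>(z, w). \<Sum>i\<le>n. \<Sum>j\<le>n. c i j * z ^ i * w ^ j)"
    using assms(1) unfolding hol_poly2_def by blast
  then show ?thesis using mon[where c=c and n=n] by (simp add: case_prod_unfold)
qed

lemma hol_poly2_continuous_on: "hol_poly2 f \<Longrightarrow> continuous_on S f"
  by (induction f rule: hol_poly2_induct) (auto intro!: continuous_intros)

text \<open>Puts every polynomial that vanishes at \<open>y\<close> into the ideal generated by the
  two coordinate differences. The product case is a Leibniz rule with one factor frozen at
  \<open>y\<close>.\<close>

lemma hol_poly2_diff_eq:
  assumes "hol_poly2 f"
  shows "\<exists>g h. hol_poly2 g \<and> hol_poly2 h \<and>
     (\<forall>x. f x - f y = (fst x - fst y) * g x + (snd x - snd y) * h x)"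
  using assms
proof (induction f rule: hol_poly2_induct)
  case (const c)
  show ?case by (intro exI[of _ "\<lambda>_. 0"] conjI hol_poly2_const) auto
next
  case fst
  show ?case by (rule exI[of _ "\<lambda>_. 1"], rule exI[of _ "\<lambda>_. 0"]) (auto intro: hol_poly2_const)
next
  case snd
  show ?case by (rule exI[of _ "\<lambda>_. 0"], rule exI[of _ "\<lambda>_. 1"]) (auto intro: hol_poly2_const)
next
  case (add f1 f2)
  obtain g1 h1 where 1: "hol_poly2 g1" "hol_poly2 h1"
    "\<And>x. f1 x - f1 y = (fst x - fst y) * g1 x + (snd x - snd y) * h1 x" using add by blast
  obtain g2 h2 where 2: "hol_poly2 g2" "hol_poly2 h2"
    "\<And>x. f2 x - f2 y = (fst x - fst y) * g2 x + (snd x - snd y) * h2 x" using add by blast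
  have "f1 x + f2 x - (f1 y + f2 y) = (fst x - fst y) * (g1 x + g2 x) + (snd x - snd y) * (h1 x + h2 x)" for x
  proof -
    have "f1 x + f2 x - (f1 y + f2 y) = (f1 x - f1 y) + (f2 x - f2 y)" by simp
    then show ?thesis unfolding 1(3) 2(3) by (simp add: algebra_simps)
  qed
  then show ?case using 1 2 by (blast intro: hol_poly2_add)
next
  case (mult f1 f2)
  obtain g1 h1 where 1: "hol_poly2 g1" "hol_poly2 h1"
    "\<And>x. f1 x - f1 y = (fst x - fst y) * g1 x + (snd x - snd y) * h1 x" using mult by blast
  obtain g2 h2 where 2: "hol_poly2 g2" "hol_poly2 h2"
    "\<And>x. f2 x - f2 y = (fst x - fst y) * g2 x + (snd x - snd y) * h2 x" using mult by blast
  have "f1 x * f2 x - f1 y * f2 y = (fst x - fst y) * (g1 x * f2 x + f1 y * g2 x)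
     + (snd x - snd y) * (h1 x * f2 x + f1 y * h2 x)" for x
  proof -
    have "f1 x * f2 x - f1 y * f2 y = (f1 x - f1 y) * f2 x + f1 y * (f2 x - f2 y)"
      by (simp add: algebra_simps)
    then show ?thesis unfolding 1(3) 2(3) by (simp add: algebra_simps)
  qed
  moreover have "hol_poly2 (\<lambda>x. g1 x * f2 x + f1 y * g2 x)" "hol_poly2 (\<lambda>x. h1 x * f2 x + f1 y * h2 x)"
    using 1 2 mult.hyps by (auto intro!: hol_poly2_add hol_poly2_mult hol_poly2_const)
  ultimately show ?case by blast
qed

section \<open>Invertibility in function algebras\<close>

text \<open>Axioms for a uniform algebra on \<open>X\<close>. Completeness enters only through
  \<open>neumann\<close>, the geometric series in \<open>1 - f\<close>. Elements are total
  functions, but bounds concern \<open>X\<close> only.\<close>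

locale function_algebra =
  fixes X :: "'a set" and A :: "('a \<Rightarrow> complex) set"
  assumes const: "(\<lambda>_. c) \<in> A"
    and add: "f \<in> A \<Longrightarrow> g \<in> A \<Longrightarrow> (\<lambda>x. f x + g x) \<in> A"
    and mult: "f \<in> A \<Longrightarrow> g \<in> A \<Longrightarrow> (\<lambda>x. f x * g x) \<in> A"
    and bounded: "f \<in> A \<Longrightarrow> \<exists>B. \<forall>x\<in>X. norm (f x) \<le> B"
    and neumann: "f \<in> A \<Longrightarrow> q < 1 \<Longrightarrow> (\<forall>x\<in>X. norm (1 - f x) \<le> q) \<Longrightarrow> (\<lambda>x. inverse (f x)) \<in> A"
begin

lemma diff: "f \<in> A \<Longrightarrow> g \<in> A \<Longrightarrow> (\<lambda>x. f x - g x) \<in> A"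
  using add[of f, OF _ mult[OF const[of "-1"]], of g] by simp

lemma power: "f \<in> A \<Longrightarrow> (\<lambda>x. f x ^ n) \<in> A"
  by (induction n) (simp_all add: const mult)

text \<open>Membership in the ideal generated by \<open>v\<close>, tested on \<open>X\<close>;
  \<open>multiple_of v (\<lambda>x. 1 - b x * y x)\<close> says that \<open>b\<close> inverts
  \<open>y\<close> in the quotient algebra.\<close>

definition multiple_of :: "('a \<Rightarrow> complex) \<Rightarrow> ('a \<Rightarrow> complex) \<Rightarrow> bool" where
  "multiple_of v f \<longleftrightarrow> (\<exists>a\<in>A. \<forall>x\<in>X. f x = a x * v x)"

lemma multiple_of_add: "multiple_of v f \<Longrightarrow> multiple_of v g \<Longrightarrow> multiple_of v (\<lambda>x. f x + g x)"
  unfolding multiple_of_def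
proof (elim bexE)
  fix a b assume "a \<in> A" "b \<in> A" "\<forall>x\<in>X. f x = a x * v x" "\<forall>x\<in>X. g x = b x * v x"
  then show "\<exists>a\<in>A. \<forall>x\<in>X. f x + g x = a x * v x"
    by (intro bexI[of _ "\<lambda>x. a x + b x"] add) (auto simp: ring_distribs)
qed

lemma multiple_of_mult: "h \<in> A \<Longrightarrow> multiple_of v f \<Longrightarrow> multiple_of v (\<lambda>x. h x * f x)"
  unfolding multiple_of_def
proof (elim bexE)
  fix a assume "h \<in> A" "a \<in> A" "\<forall>x\<in>X. f x = a x * v x"
  then show "\<exists>a\<in>A. \<forall>x\<in>X. h x * f x = a x * v x"
    by (intro bexI[of _ "\<lambda>x. h x * a x"] mult) auto
qed

lemma multiple_of_cong: "multiple_of v f \<Longrightarrow> (\<And>x. x \<in> X \<Longrightarrow> g x = f x) \<Longrightarrow> multiple_of v g"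
  unfolding multiple_of_def by auto

text \<open>The numbers \<open>r\<close> bounding the norm of some inverse of \<open>u - l\<close> modulo the ideal generated by \<open>v\<close>.\<close>
definition inv_bound :: "('a \<Rightarrow> complex) \<Rightarrow> ('a \<Rightarrow> complex) \<Rightarrow> complex \<Rightarrow> real \<Rightarrow> bool" where
  "inv_bound u v l r \<longleftrightarrow> r > 0 \<and>
     (\<exists>b\<in>A. multiple_of v (\<lambda>x. 1 - b x * (u x - l)) \<and> (\<forall>x\<in>X. norm (b x) \<le> r))"

lemma inv_bound_mono: "inv_bound u v l r \<Longrightarrow> r \<le> s \<Longrightarrow> inv_bound u v l s"
  unfolding inv_bound_def by (meson less_le_trans order_trans)

text \<open>If the product were below 1, \<open>neumann\<close> would make
  \<open>1 - b x * (u x - l)\<close> a unit; but it is a multiple of \<open>v\<close>, and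
  \<open>noinv\<close> allows no unit to be one.\<close>

lemma inv_bound_lower:
  assumes noinv: "\<not> multiple_of v (\<lambda>_. 1)" and uA: "u \<in> A"
    and C: "\<forall>x\<in>X. norm (u x) \<le> C"
    and r: "inv_bound u v l r"
  shows "r * (C + norm l) \<ge> 1"
proof (rule ccontr)
  assume less: "\<not> r * (C + norm l) \<ge> 1"
  obtain b where b: "r > 0" "b \<in> A" "multiple_of v (\<lambda>x. 1 - b x * (u x - l))" "\<forall>x\<in>X. norm (b x) \<le> r"
    using r unfolding inv_bound_def by blast
  define f where "f = (\<lambda>x. 1 - b x * (u x - l))"
  have fA: "f \<in> A" unfolding f_def using b uA by (intro diff mult const)
  have le: "\<forall>x\<in>X. norm (1 - f x) \<le> r * (C + norm l)"
  proof
    fix x assume x: "x \<in> X"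
    have "norm (1 - f x) = norm (b x) * norm (u x - l)" by (simp add: f_def norm_mult)
    also have "\<dots> \<le> r * (C + norm l)"
    proof (intro mult_mono)
      show "norm (u x - l) \<le> C + norm l"
        using C x norm_triangle_ineq4[of "u x" l] by force
    qed (use x b in auto)
    finally show "norm (1 - f x) \<le> r * (C + norm l)" .
  qed
  have "(\<lambda>x. inverse (f x)) \<in> A"
    using neumann[OF fA _ le] less by simp
  then have m: "multiple_of v (\<lambda>x. inverse (f x) * f x)"
    using b(3) unfolding f_def by (rule multiple_of_mult)
  have nz: "f x \<noteq> 0" if "x \<in> X" for x
    using le that less by force
  have "multiple_of v (\<lambda>_. 1)"
    by (rule multiple_of_cong[OF m]) (simp add: nz)
  with noinv show False ..
qed

text \<open>Modulo \<open>v\<close>, \<open>b\<close> times \<open>u - l'\<close> equals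
  \<open>1 - b * (l' - l)\<close>, a unit by \<open>neumann\<close>; dividing \<open>b\<close> by it
  inverts \<open>u - l'\<close>. The reciprocal of the new bound is
  \<open>1 / r - norm (l' - l)\<close>.\<close>

lemma inv_bound_shift:
  assumes uA: "u \<in> A" and r: "inv_bound u v l r" and less: "norm (l' - l) * r < 1"
  shows "inv_bound u v l' (r / (1 - norm (l' - l) * r))"
proof -
  obtain b where b: "r > 0" "b \<in> A" "multiple_of v (\<lambda>x. 1 - b x * (u x - l))" "\<forall>x\<in>X. norm (b x) \<le> r"
    using r unfolding inv_bound_def by blast
  define f where "f = (\<lambda>x. 1 - b x * (l' - l))"
  have fA: "f \<in> A" unfolding f_def using b uA by (intro diff mult const)
  have le: "norm (b x * (l' - l)) \<le> norm (l' - l) * r" if "x \<in> X" for x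
    using that b by (simp add: norm_mult mult.commute mult_right_mono)
  then have iA: "(\<lambda>x. inverse (f x)) \<in> A"
    using neumann[OF fA less] unfolding f_def by simp
  have ge: "norm (f x) \<ge> 1 - norm (l' - l) * r" if "x \<in> X" for x
    using le[OF that] norm_triangle_ineq2[of 1 "b x * (l' - l)"] unfolding f_def norm_one by linarith
  have nz: "f x \<noteq> 0" if "x \<in> X" for x using ge[OF that] less by auto
  define b' where "b' = (\<lambda>x. inverse (f x) * b x)"
  have "multiple_of v (\<lambda>x. 1 - b' x * (u x - l'))"
  proof (rule multiple_of_cong[OF multiple_of_mult[OF iA b(3)]])
    fix x assume "x \<in> X"
    have "inverse (f x) * (1 - b x * (u x - l)) = inverse (f x) * (f x - b x * (u x - l'))"
      by (simp add: f_def algebra_simps)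
    also have "\<dots> = 1 - b' x * (u x - l')"
      using nz[OF \<open>x \<in> X\<close>] by (simp add: b'_def right_diff_distrib)
    finally show "1 - b' x * (u x - l') = inverse (f x) * (1 - b x * (u x - l))" by simp
  qed
  moreover have "norm (b' x) \<le> r / (1 - norm (l' - l) * r)" if "x \<in> X" for x
  proof -
    have "norm (b' x) = norm (b x) / norm (f x)" by (simp add: b'_def norm_mult norm_inverse divide_inverse mult.commute)
    also have "\<dots> \<le> r / (1 - norm (l' - l) * r)"
      using b that ge[OF that] less by (intro frac_le) auto
    finally show ?thesis .
  qed
  moreover have "b' \<in> A" unfolding b'_def by (intro mult iA b)
  ultimately show ?thesis using less b(1) unfolding inv_bound_def by auto
qed

text \<open>For \<open>norm l > C\<close> the function \<open>u - l\<close> is a unit of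
  \<open>A\<close> itself, by the geometric series in \<open>u / l\<close>. The bound tends to 0 at
  infinity, as the maximum principle will require.\<close>

lemma inv_bound_far:
  assumes uA: "u \<in> A" and C: "\<forall>x\<in>X. norm (u x) \<le> C" and C0: "C \<ge> 0" and l: "norm l > C"
  shows "inv_bound u v l (1 / (norm l - C))"
proof -
  have l0: "l \<noteq> 0" using l C0 by auto
  define f where "f = (\<lambda>x. 1 - u x * (1 / l))"
  have fA: "f \<in> A" unfolding f_def using uA by (intro diff mult const)
  have q: "C / norm l < 1" using l C0 l0 by simp
  have "norm (1 - f x) \<le> C / norm l" if "x \<in> X" for x
    using C that l0 by (simp add: f_def norm_divide divide_right_mono)
  then have iA: "(\<lambda>x. inverse (f x)) \<in> A"
    using neumann[OF fA q] by blast
  define b where "b = (\<lambda>x. (- 1 / l) * inverse (f x))"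
  have bA: "b \<in> A" unfolding b_def by (intro mult const iA)
  have ge: "norm (u x - l) \<ge> norm l - C" if "x \<in> X" for x
    using C that norm_triangle_ineq2[of l "u x"] by (auto simp: norm_minus_commute)
  have beq: "b x = 1 / (u x - l)" and nz: "u x - l \<noteq> 0" if "x \<in> X" for x
  proof -
    show nz: "u x - l \<noteq> 0" using ge[OF that] l by auto
    have "f x = (l - u x) / l" using l0 by (simp add: f_def field_simps)
    then have "b x = - 1 / (l - u x)" using l0 by (simp add: b_def)
    then show "b x = 1 / (u x - l)" by (simp add: minus_divide_right)
  qed
  have "multiple_of v (\<lambda>x. 1 - b x * (u x - l))"
    unfolding multiple_of_def
    by (rule bexI[OF _ const[of 0]]) (use beq nz in fastforce)
  moreover have "norm (b x) \<le> 1 / (norm l - C)" if "x \<in> X" for x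
    unfolding beq[OF that] norm_divide norm_one using ge[OF that] l by (intro frac_le) auto
  ultimately show ?thesis using bA l unfolding inv_bound_def by auto
qed

text \<open>With \<open>y = u - l\<close>, the average of \<open>1/(y - r)\<close> over the four points \<open>r, \<i>r, -r, -\<i>r\<close>
  equals \<open>y\<^sup>3/(y\<^sup>4 - r\<^sup>4)\<close>; the error is thus of higher order than \<open>r\<^sup>2\<close>.\<close>
lemma inv_bound_mean:
  assumes uA: "u \<in> A" and s: "inv_bound u v l s"
    and r: "r > 0" and sk: "\<And>k::nat. k < 4 \<Longrightarrow> inv_bound u v (l + of_real r * \<i> ^ k) (t k)"
  shows "inv_bound u v l ((t 0 + t 1 + t 2 + t 3) / 4 * (1 + (r * s) ^ 4))"
proof -
  obtain c where c: "s > 0" "c \<in> A" "multiple_of v (\<lambda>x. 1 - c x * (u x - l))" "\<forall>x\<in>X. norm (c x) \<le> s"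
    using s unfolding inv_bound_def by blast
  have "\<exists>b. \<forall>k<4. t k > 0 \<and> b k \<in> A \<and> multiple_of v (\<lambda>x. 1 - b k x * (u x - (l + of_real r * \<i> ^ k)))
       \<and> (\<forall>x\<in>X. norm (b k x) \<le> t k)"
    using sk unfolding inv_bound_def by metis
  then obtain b where b: "\<And>k::nat. k < 4 \<Longrightarrow> t k > 0" "\<And>k. k < 4 \<Longrightarrow> b k \<in> A"
     "\<And>k. k < 4 \<Longrightarrow> multiple_of v (\<lambda>x. 1 - b k x * (u x - (l + of_real r * \<i> ^ k)))"
     "\<And>k x. k < 4 \<Longrightarrow> x \<in> X \<Longrightarrow> norm (b k x) \<le> t k"
    by blast
  define R :: complex where "R = of_real r"
  define y where "y = (\<lambda>x. u x - l)"
  have yA: "y \<in> A" unfolding y_def by (intro diff uA const)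
  have y: "u x = y x + l" for x by (simp add: y_def)
  have i3: "\<i> ^ 3 = - \<i>" by (simp add: power3_eq_cube)
  have m0: "multiple_of v (\<lambda>x. 1 - b 0 x * (y x - R))"
    and m1: "multiple_of v (\<lambda>x. 1 - b 1 x * (y x - \<i> * R))"
    and m2: "multiple_of v (\<lambda>x. 1 - b 2 x * (y x + R))"
    and m3: "multiple_of v (\<lambda>x. 1 - b 3 x * (y x + \<i> * R))"
    using b(3)[of 0] b(3)[of 1] b(3)[of 2] b(3)[of 3]
    by (simp_all add: y R_def i3 algebra_simps)
  have mc: "multiple_of v (\<lambda>x. 1 - c x * y x)" using c(3) by (simp add: y)
  define B where "B = (\<lambda>x. (1/4) * (b 0 x + b 1 x + b 2 x + b 3 x))"
  have BA: "B \<in> A" unfolding B_def by (intro mult const add b) auto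
  \<comment> \<open>Modulo \<open>v\<close>, \<open>c\<close> is \<open>1 / y\<close> and
    \<open>B\<close> satisfies \<open>B * (y^4 - R^4) = y^3\<close>; hence this product is
    \<open>1 / y\<close> exactly.\<close>
  define g where "g = (\<lambda>x. B x * (1 - (R * c x) ^ 4))"
  have gA: "g \<in> A" unfolding g_def by (intro mult diff power const BA c)
  have "multiple_of v (\<lambda>x. 1 - g x * y x)"
  proof -
    \<comment> \<open>The cofactors of the four linear factors of \<open>y^4 - R^4\<close>; their
      sum is \<open>4 * y^3\<close>.\<close>
    define p0 where "p0 = (\<lambda>x. (y x + R) * (y x * y x + R * R))"
    define p1 where "p1 = (\<lambda>x. (y x + \<i> * R) * (y x * y x - R * R))"
    define p2 where "p2 = (\<lambda>x. (y x - R) * (y x * y x + R * R))"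
    define p3 where "p3 = (\<lambda>x. (y x - \<i> * R) * (y x * y x - R * R))"
    have pA: "p0 \<in> A" "p1 \<in> A" "p2 \<in> A" "p3 \<in> A"
      unfolding p0_def p1_def p2_def p3_def by (intro mult add diff yA const)+
    have M: "multiple_of v (\<lambda>x. (1/4) * (p0 x * (1 - b 0 x * (y x - R)) + p1 x * (1 - b 1 x * (y x - \<i> * R))
       + p2 x * (1 - b 2 x * (y x + R)) + p3 x * (1 - b 3 x * (y x + \<i> * R))))"
      by (intro multiple_of_mult multiple_of_add const pA m0 m1 m2 m3)
    have i2: "\<i> ^ 2 = - 1" by simp
    have E: "(1/4) * (p0 x * (1 - b 0 x * (y x - R)) + p1 x * (1 - b 1 x * (y x - \<i> * R))
       + p2 x * (1 - b 2 x * (y x + R)) + p3 x * (1 - b 3 x * (y x + \<i> * R)))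
       = y x ^ 3 - B x * (y x ^ 4 - R ^ 4)" for x
    proof -
      have q: "p0 x * (y x - R) = y x ^ 4 - R ^ 4" "p2 x * (y x + R) = y x ^ 4 - R ^ 4"
        unfolding p0_def p2_def by (simp_all add: algebra_simps power4_eq_xxxx)
      have "p1 x * (y x - \<i> * R) = y x ^ 4 - R ^ 4" unfolding p1_def using i2 by algebra
      moreover have "p3 x * (y x + \<i> * R) = y x ^ 4 - R ^ 4" unfolding p3_def using i2 by algebra
      moreover note q
      ultimately have q: "p0 x * (y x - R) = y x ^ 4 - R ^ 4" "p1 x * (y x - \<i> * R) = y x ^ 4 - R ^ 4"
        "p2 x * (y x + R) = y x ^ 4 - R ^ 4" "p3 x * (y x + \<i> * R) = y x ^ 4 - R ^ 4"
        by simp_all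
      have q': "p0 x + p1 x + p2 x + p3 x = 4 * y x ^ 3"
        unfolding p0_def p1_def p2_def p3_def by algebra
      have "p0 x * (1 - b 0 x * (y x - R)) + p1 x * (1 - b 1 x * (y x - \<i> * R))
       + p2 x * (1 - b 2 x * (y x + R)) + p3 x * (1 - b 3 x * (y x + \<i> * R))
       = (p0 x + p1 x + p2 x + p3 x) - (b 0 x * (p0 x * (y x - R)) + b 1 x * (p1 x * (y x - \<i> * R))
       + b 2 x * (p2 x * (y x + R)) + b 3 x * (p3 x * (y x + \<i> * R)))"
        by (simp add: algebra_simps)
      also have "\<dots> = 4 * y x ^ 3 - (b 0 x + b 1 x + b 2 x + b 3 x) * (y x ^ 4 - R ^ 4)"
        unfolding q q' by (simp add: algebra_simps)
      finally have S: "p0 x * (1 - b 0 x * (y x - R)) + p1 x * (1 - b 1 x * (y x - \<i> * R))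
       + p2 x * (1 - b 2 x * (y x + R)) + p3 x * (1 - b 3 x * (y x + \<i> * R))
       = 4 * y x ^ 3 - (b 0 x + b 1 x + b 2 x + b 3 x) * (y x ^ 4 - R ^ 4)" .
      show ?thesis unfolding S B_def by algebra
    qed
    have M': "multiple_of v (\<lambda>x. y x ^ 3 - B x * (y x ^ 4 - R ^ 4))"
      using M by (rule multiple_of_cong) (simp only: E)
    \<comment> \<open>The geometric sum that turns the relation for \<open>c * y\<close> into the
      one for its fourth power.\<close>
    define h where "h = (\<lambda>x. (1 + c x * y x) * (1 + (c x * y x) ^ 2))"
    have hA: "h \<in> A" unfolding h_def by (intro mult add power const c yA)
    have N: "multiple_of v (\<lambda>x. (c x ^ 4 * y x) * (y x ^ 3 - B x * (y x ^ 4 - R ^ 4))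
        + ((1 - B x * y x) * h x) * (1 - c x * y x))"
      by (intro multiple_of_add multiple_of_mult M' mc mult power diff const c yA BA hA)
    show ?thesis
    proof (rule multiple_of_cong[OF N])
      fix x
      have "h x * (1 - c x * y x) = 1 - (c x * y x) ^ 4"
        unfolding h_def by algebra
      then have e: "((1 - B x * y x) * h x) * (1 - c x * y x) = (1 - B x * y x) * (1 - (c x * y x) ^ 4)"
        by (simp add: mult.assoc)
      show "1 - g x * y x = (c x ^ 4 * y x) * (y x ^ 3 - B x * (y x ^ 4 - R ^ 4))
        + ((1 - B x * y x) * h x) * (1 - c x * y x)"
        unfolding e g_def by algebra
    qed
  qed
  moreover have "norm (g x) \<le> (t 0 + t 1 + t 2 + t 3) / 4 * (1 + (r * s) ^ 4)" if x: "x \<in> X" for x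
  proof -
    have 1: "norm (B x) \<le> (t 0 + t 1 + t 2 + t 3) / 4"
    proof -
      have "norm (b 0 x + b 1 x + b 2 x + b 3 x) \<le> t 0 + t 1 + t 2 + t 3"
        using b(4)[OF _ x] by (intro norm_triangle_mono) auto
      then show ?thesis unfolding B_def by (simp add: norm_mult)
    qed
    have "norm (R * c x) \<le> r * s" using c(4) x r by (simp add: norm_mult R_def)
    then have "norm ((R * c x) ^ 4) \<le> (r * s) ^ 4" unfolding norm_power by (intro power_mono) auto
    then have 2: "norm (1 - (R * c x) ^ 4) \<le> 1 + (r * s) ^ 4"
      using norm_triangle_ineq4[of 1 "(R * c x) ^ 4"] by (simp only: norm_one)
    show ?thesis unfolding g_def norm_mult
      using 1 2 b(1)[of 0] b(1)[of 1] b(1)[of 2] b(1)[of 3] by (intro mult_mono) auto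
  qed
  moreover have "(t 0 + t 1 + t 2 + t 3) / 4 * (1 + (r * s) ^ 4) > 0"
    using b(1)[of 0] b(1)[of 1] b(1)[of 2] b(1)[of 3] c(1) r
    by (intro mult_pos_pos add_pos_nonneg) auto
  ultimately show ?thesis using gA unfolding inv_bound_def y_def by blast
qed


text \<open>If \<open>v\<close> is not invertible, let \<open>\<rho> l\<close> be the least norm of an inverse of \<open>u - l\<close> modulo \<open>v\<close>.
  It is positive, \<open>1/\<rho>\<close> is 1-Lipschitz, and \<open>\<rho>\<close> is subharmonic and vanishes at infinity, which
  contradicts the maximum principle. This replaces the Gelfand--Mazur theorem for the
  quotient algebra.\<close>
lemma invertible_if_comaximal:
  assumes ne: "X \<noteq> {}" and uA: "u \<in> A"
    and com: "\<And>l. \<exists>a\<in>A. \<exists>b\<in>A. \<forall>x\<in>X. a x * v x + b x * (u x - l) = 1"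
  shows "\<exists>c\<in>A. \<forall>x\<in>X. c x * v x = 1"
proof (rule ccontr)
  assume "\<not> ?thesis"
  then have noinv: "\<not> multiple_of v (\<lambda>_. 1)" unfolding multiple_of_def by metis
  obtain C0 where C0: "\<forall>x\<in>X. norm (u x) \<le> C0" using bounded[OF uA] by blast
  define C where "C = max C0 1"
  have C: "\<forall>x\<in>X. norm (u x) \<le> C" "C \<ge> 1" using C0 by (auto simp: C_def)
  let ?I = "inv_bound u v"
  have ex: "\<exists>r. ?I l r" for l
  proof -
    obtain a b where ab: "a \<in> A" "b \<in> A" "\<forall>x\<in>X. a x * v x + b x * (u x - l) = 1"
      using com by blast
    obtain B where B: "\<forall>x\<in>X. norm (b x) \<le> B" using bounded ab by blast
    have "multiple_of v (\<lambda>x. 1 - b x * (u x - l))"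
      unfolding multiple_of_def using ab by (intro bexI[of _ a]) (auto simp: algebra_simps)
    then have "?I l (max B 1)" unfolding inv_bound_def using ab B by force
    then show ?thesis ..
  qed
  \<comment> \<open>Reciprocals of the bounds: they are at most \<open>C + norm l\<close>, and a
    shift of \<open>l\<close> acts on them by subtraction, so that their supremum \<open>d\<close>
    is 1-Lipschitz.\<close>
  define T where "T l = {t. t > 0 \<and> ?I l (1 / t)}" for l
  have T_le: "t \<le> C + norm l" if "t \<in> T l" for t l
    using inv_bound_lower[OF noinv uA C(1), of l "1 / t"] that by (auto simp: T_def field_simps)
  have T_ne: "T l \<noteq> {}" for l
  proof -
    obtain r where "?I l r" using ex by blast
    then have "1 / r \<in> T l" by (auto simp: T_def inv_bound_def)
    then show ?thesis by blast
  qed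
  have T_bdd: "bdd_above (T l)" for l using T_le by (intro bdd_aboveI) blast
  have T_shift: "t - norm (l' - l) \<in> T l'" if "t \<in> T l" "norm (l' - l) < t" for t l l'
  proof -
    have "?I l' (1 / t / (1 - norm (l' - l) * (1 / t)))"
      using that by (intro inv_bound_shift uA) (auto simp: T_def)
    also have "1 / t / (1 - norm (l' - l) * (1 / t)) = 1 / (t - norm (l' - l))"
      using that by (simp add: T_def field_simps)
    finally show ?thesis using that by (simp add: T_def)
  qed
  define d where "d l = Sup (T l)" for l
  have d_up: "t \<le> d l" if "t \<in> T l" for t l unfolding d_def using that T_bdd by (rule cSup_upper)
  have d_pos: "d l > 0" for l
  proof -
    obtain t where "t \<in> T l" using T_ne by blast
    then show ?thesis using d_up[of t l] by (auto simp: T_def)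
  qed
  have d_shift: "d l \<le> d l' + norm (l' - l)" for l l'
    unfolding d_def[of l]
  proof (rule cSup_least[OF T_ne])
    fix t assume t: "t \<in> T l"
    show "t \<le> d l' + norm (l' - l)"
    proof (cases "norm (l' - l) < t")
      case True
      then show ?thesis using d_up[OF T_shift[OF t True]] by simp
    qed (use d_pos[of l'] in linarith)
  qed
  have d_cont: "continuous_on S d" for S
  proof -
    have "1-lipschitz_on S d"
    proof (rule lipschitz_onI)
      fix x y
      show "dist (d x) (d y) \<le> 1 * dist x y"
        using d_shift[of x y] d_shift[of y x] by (simp add: dist_norm norm_minus_commute abs_le_iff)
    qed simp
    then show ?thesis by (rule lipschitz_on_continuous_on)
  qed
  define \<rho> where "\<rho> l = 1 / d l" for l
  have \<rho>_pos: "\<rho> l > 0" for l using d_pos[of l] by (simp add: \<rho>_def)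
  have \<rho>_cont: "continuous_on S \<rho>" for S
    unfolding \<rho>_def using d_pos by (intro continuous_intros d_cont) (auto simp: less_imp_neq[symmetric])
  have \<rho>_le: "\<rho> l \<le> r" if "?I l r" for l r
  proof -
    have r: "r > 0" using that by (simp add: inv_bound_def)
    then have "1 / r \<le> d l" using that by (intro d_up) (simp add: T_def)
    then show ?thesis using r d_pos[of l] by (simp add: \<rho>_def field_simps)
  qed
  have \<rho>_I: "?I l s" if "s > \<rho> l" for l s
  proof -
    have s: "s > 0" using that \<rho>_pos[of l] by linarith
    have "1 / s < d l" using that s d_pos[of l] by (simp add: \<rho>_def field_simps)
    then obtain t where t: "t \<in> T l" "1 / s < t"
      unfolding d_def using less_cSupD[OF T_ne] by blast
    then have "?I l (1 / t)" by (simp add: T_def)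
    moreover have "1 / t \<le> s" using t s by (simp add: T_def field_simps)
    ultimately show ?thesis by (rule inv_bound_mono)
  qed
  have mean: "\<rho> l \<le> (\<rho> (l + r) + \<rho> (l + r * \<i>) + \<rho> (l - r) + \<rho> (l - r * \<i>)) / 4 * (1 + (r * s) ^ 4)"
    if s: "?I l s" and r: "r > 0" for l :: complex and s r :: real
  proof -
    let ?t = "\<lambda>k. \<rho> (l + of_real r * \<i> ^ k)"
    have i3: "\<i> ^ 3 = - \<i>" by (simp add: power3_eq_cube)
    have sum_t: "?t 0 + ?t 1 + ?t 2 + ?t 3 = \<rho> (l + r) + \<rho> (l + r * \<i>) + \<rho> (l - r) + \<rho> (l - r * \<i>)"
      by (simp add: i3)
    have s0: "s > 0" using s by (simp add: inv_bound_def)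
    let ?c = "1 + (r * s) ^ 4"
    have c: "?c > 0" by (simp add: add_pos_nonneg)
    \<comment> \<open>The infimum \<open>\<rho>\<close> need not be attained, so each of the four
      values is enlarged by \<open>h\<close>, chosen so that the total loss is
      \<open>e\<close>.\<close>
    have "\<rho> l \<le> (?t 0 + ?t 1 + ?t 2 + ?t 3) / 4 * ?c + e" if e: "e > 0" for e
    proof -
      define h where "h = e / ?c"
      have h: "h > 0" "h * ?c = e" using e c by (simp_all only: h_def) (auto intro: divide_pos_pos)
      have "?I l (((?t 0 + h) + (?t 1 + h) + (?t 2 + h) + (?t 3 + h)) / 4 * ?c)"
        by (rule inv_bound_mean[OF uA s r, of "\<lambda>k. ?t k + h"]) (use h in \<open>auto intro!: \<rho>_I\<close>)
      from \<rho>_le[OF this]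
      have "\<rho> l \<le> ((?t 0 + ?t 1 + ?t 2 + ?t 3) / 4 + h) * ?c" by (simp add: field_simps)
      then show ?thesis using h(2) by (simp only: ring_distribs)
    qed
    then have "\<rho> l \<le> (?t 0 + ?t 1 + ?t 2 + ?t 3) / 4 * ?c" by (rule field_le_epsilon)
    then show ?thesis unfolding sum_t .
  qed
  \<comment> \<open>\<open>R\<close> makes \<open>1 / (R - C)\<close>, the bound for
    \<open>\<rho>\<close> on the circle of radius \<open>R\<close>, half of \<open>\<rho> 0\<close>;
    \<open>\<epsilon>\<close> makes the added term there a quarter of it. So \<open>\<phi>\<close>
    stays below \<open>\<phi> 0\<close> on the circle and its maximum is interior.\<close>
  define R where "R = C + 2 / \<rho> 0"
  define \<epsilon> where "\<epsilon> = \<rho> 0 / (4 * R ^ 2)"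
  have R: "R > C" "R > 0" using \<rho>_pos[of 0] C(2) by (auto simp: R_def add_pos_pos)
  have \<epsilon>: "\<epsilon> > 0" "\<epsilon> * R ^ 2 = \<rho> 0 / 4" using \<rho>_pos[of 0] R by (auto simp: \<epsilon>_def)
  \<comment> \<open>The quadratic term makes subharmonicity strict: it contributes
    \<open>\<epsilon> * r^2\<close> to the mean over the four points, against an error of order
    \<open>r^4\<close>.\<close>
  define \<phi> where "\<phi> l = \<rho> l + \<epsilon> * norm l ^ 2" for l
  have "continuous_on (cball 0 R) \<phi>" unfolding \<phi>_def by (intro continuous_intros \<rho>_cont)
  then obtain m where m: "m \<in> cball 0 R" "\<And>l. l \<in> cball 0 R \<Longrightarrow> \<phi> l \<le> \<phi> m"
    using continuous_attains_sup[of "cball 0 R" \<phi>] R(2) by force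
  show False
  proof (cases "norm m = R")
    case True
    have "\<rho> m \<le> 1 / (R - C)"
      using \<rho>_le[OF inv_bound_far[OF uA C(1)]] R(1) C(2) True by auto
    also have "\<dots> = \<rho> 0 / 2" using \<rho>_pos[of 0] by (simp add: R_def)
    finally have "\<phi> m \<le> 3 * \<rho> 0 / 4" using \<epsilon>(2) by (simp add: \<phi>_def True)
    moreover have "\<phi> 0 \<le> \<phi> m" using m(2)[of 0] R by simp
    ultimately show False using \<rho>_pos[of 0] by (simp add: \<phi>_def)
  next
    case False
    then have mR: "norm m < R" using m(1) by simp
    obtain s where s: "?I m s" using ex by blast
    have s0: "s > 0" using s by (simp add: inv_bound_def)
    \<comment> \<open>The error term is \<open>K * r^4\<close>; \<open>r\<close> is chosen so that
      \<open>K * r^2\<close> is at most half of \<open>\<epsilon>\<close> and the four points stay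
      in the disc.\<close>
    define K where "K = \<rho> m * s ^ 4"
    have K: "K > 0" using s0 \<rho>_pos by (simp add: K_def)
    define r where "r = min (R - norm m) (sqrt (\<epsilon> / (2 * K)))"
    have r: "r > 0" "r \<le> R - norm m" using mR \<epsilon> K by (auto simp: r_def)
    have "r ^ 2 \<le> sqrt (\<epsilon> / (2 * K)) ^ 2" using r(1) by (intro power_mono) (auto simp: r_def)
    then have rK: "r ^ 2 * K < \<epsilon>" using \<epsilon>(1) K by (simp add: field_simps)
    have le: "\<rho> (m + z) \<le> \<rho> m + \<epsilon> * norm m ^ 2 - \<epsilon> * norm (m + z) ^ 2" if "norm z = r" for z
      using m(2)[of "m + z"] that r(2) norm_triangle_ineq[of m z] by (simp add: \<phi>_def)
    have "norm (m + r) ^ 2 + norm (m + r * \<i>) ^ 2 + norm (m - r) ^ 2 + norm (m - r * \<i>) ^ 2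
      = 4 * norm m ^ 2 + 4 * r ^ 2"
      unfolding cmod_power2 by (simp add: power2_eq_square algebra_simps)
    then have "\<epsilon> * norm (m + r) ^ 2 + \<epsilon> * norm (m + r * \<i>) ^ 2 + \<epsilon> * norm (m - r) ^ 2 + \<epsilon> * norm (m - r * \<i>) ^ 2
      = \<epsilon> * (4 * norm m ^ 2 + 4 * r ^ 2)" by (metis distrib_left)
    then have "\<rho> (m + r) + \<rho> (m + r * \<i>) + \<rho> (m - r) + \<rho> (m - r * \<i>) \<le> 4 * (\<rho> m - \<epsilon> * r ^ 2)"
      using le[of r] le[of "r * \<i>"] le[of "- r"] le[of "- r * \<i>"] r(1)
      by (simp add: norm_mult algebra_simps)
    then have "(\<rho> (m + r) + \<rho> (m + r * \<i>) + \<rho> (m - r) + \<rho> (m - r * \<i>)) / 4 * (1 + (r * s) ^ 4)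
       \<le> (\<rho> m - \<epsilon> * r ^ 2) * (1 + (r * s) ^ 4)"
      by (intro mult_right_mono) auto
    with mean[OF s r(1)] have "\<rho> m \<le> (\<rho> m - \<epsilon> * r ^ 2) * (1 + (r * s) ^ 4)" by (rule order_trans)
    then have "\<epsilon> * r ^ 2 + \<epsilon> * r ^ 2 * (r * s) ^ 4 \<le> \<rho> m * (r * s) ^ 4"
      by (simp add: algebra_simps)
    moreover have "\<epsilon> * r ^ 2 * (r * s) ^ 4 \<ge> 0" using \<epsilon>(1) by simp
    ultimately have "\<epsilon> * r ^ 2 \<le> \<rho> m * (r * s) ^ 4" by linarith
    also have "\<dots> = (r ^ 2 * K) * r ^ 2" by (simp add: K_def power_mult_distrib power2_eq_square power4_eq_xxxx)
    also have "\<dots> < \<epsilon> * r ^ 2" using rK r(1) by (intro mult_strict_right_mono) auto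
    finally show False by simp
  qed
qed

end

section \<open>Uniform limits of polynomials and hulls\<close>

text \<open>The algebra usually written \<open>P(X)\<close>. Values off \<open>X\<close> are
  arbitrary, so an inverse may take its default value 0 at a zero outside \<open>X\<close>.\<close>

definition poly_limits :: "(complex \<times> complex) set \<Rightarrow> (complex \<times> complex \<Rightarrow> complex) set" where
  "poly_limits X = {f. \<forall>e>0. \<exists>p. hol_poly2 p \<and> (\<forall>x\<in>X. norm (f x - p x) \<le> e)}"

lemma hol_poly2_in_poly_limits: "hol_poly2 p \<Longrightarrow> p \<in> poly_limits X"
  unfolding poly_limits_def by force

lemma poly_limits_cong: "f \<in> poly_limits X \<Longrightarrow> (\<And>x. x \<in> X \<Longrightarrow> g x = f x) \<Longrightarrow> g \<in> poly_limits X"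
  unfolding poly_limits_def by simp

lemma poly_limits_closed:
  assumes "\<And>e. e > 0 \<Longrightarrow> \<exists>g\<in>poly_limits X. \<forall>x\<in>X. norm (f x - g x) \<le> e"
  shows "f \<in> poly_limits X"
  unfolding poly_limits_def
mem_Collect_eq
proof (intro allI impI)
  fix e :: real assume e: "e > 0"
  obtain g where g: "g \<in> poly_limits X" "\<forall>x\<in>X. norm (f x - g x) \<le> e / 2"
    using assms[of "e / 2"] e by auto
  obtain p where p: "hol_poly2 p" "\<forall>x\<in>X. norm (g x - p x) \<le> e / 2"
    using g(1) e unfolding poly_limits_def by (auto dest: spec[of _ "e / 2"])
  have "norm (f x - p x) \<le> e" if "x \<in> X" for x
    using norm_triangle_mono[OF g(2)[rule_format, OF that] p(2)[rule_format, OF that]] by simp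
  with p(1) show "\<exists>p. hol_poly2 p \<and> (\<forall>x\<in>X. norm (f x - p x) \<le> e)" by blast
qed

lemma poly_limits_bounded:
  assumes "bounded X" "f \<in> poly_limits X"
  shows "\<exists>B>0. \<forall>x\<in>X. norm (f x) \<le> B"
proof -
  obtain p where p: "hol_poly2 p" "\<forall>x\<in>X. norm (f x - p x) \<le> 1"
    using assms(2) unfolding poly_limits_def by (auto dest: spec[of _ 1])
  have "compact (p ` closure X)"
    using assms(1) by (intro compact_continuous_image hol_poly2_continuous_on p) (simp add: compact_closure)
  then obtain B where "\<forall>y\<in>p ` closure X. norm y \<le> B"
    using compact_imp_bounded bounded_iff by blast
  then have B: "\<forall>x\<in>X. norm (p x) \<le> B" using closure_subset by blast
  have "norm (f x) \<le> \<bar>B\<bar> + 1" if "x \<in> X" for x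
    using that B p(2) norm_triangle_ineq2[of "f x" "p x"] by force
  then show ?thesis by (intro exI[of _ "\<bar>B\<bar> + 1"]) auto
qed

lemma poly_limits_add:
  assumes "f \<in> poly_limits X" "g \<in> poly_limits X"
  shows "(\<lambda>x. f x + g x) \<in> poly_limits X"
  unfolding poly_limits_def mem_Collect_eq
proof (intro allI impI)
  fix e :: real assume e: "e > 0"
  obtain p where p: "hol_poly2 p" "\<forall>x\<in>X. norm (f x - p x) \<le> e / 2"
    using assms(1) e unfolding poly_limits_def by (auto dest: spec[of _ "e / 2"])
  obtain q where q: "hol_poly2 q" "\<forall>x\<in>X. norm (g x - q x) \<le> e / 2"
    using assms(2) e unfolding poly_limits_def by (auto dest: spec[of _ "e / 2"])
  have "norm (f x + g x - (p x + q x)) \<le> e" if "x \<in> X" for x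
    using norm_triangle_mono[OF p(2)[rule_format, OF that] q(2)[rule_format, OF that]]
    by (simp add: algebra_simps)
  with p(1) q(1) show "\<exists>p. hol_poly2 p \<and> (\<forall>x\<in>X. norm (f x + g x - p x) \<le> e)"
    by (intro exI[of _ "\<lambda>x. p x + q x"]) (simp add: hol_poly2_add)
qed

lemma poly_limits_mult:
  assumes X: "bounded X" and f: "f \<in> poly_limits X" and g: "g \<in> poly_limits X"
  shows "(\<lambda>x. f x * g x) \<in> poly_limits X"
  unfolding poly_limits_def mem_Collect_eq
proof (intro allI impI)
  fix e :: real assume e: "e > 0"
  obtain G where G: "G > 0" "\<forall>x\<in>X. norm (g x) \<le> G" using poly_limits_bounded[OF X g] by blast
  obtain p where p: "hol_poly2 p" "\<forall>x\<in>X. norm (f x - p x) \<le> e / (2 * G)"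
    using f e G unfolding poly_limits_def by (auto dest: spec[of _ "e / (2 * G)"])
  obtain P where P: "P > 0" "\<forall>x\<in>X. norm (p x) \<le> P"
    using poly_limits_bounded[OF X hol_poly2_in_poly_limits[OF p(1)]] by blast
  \<comment> \<open>The accuracy of \<open>q\<close> depends on a bound for \<open>p\<close>, which
    is therefore fixed beforehand.\<close>
  obtain q where q: "hol_poly2 q" "\<forall>x\<in>X. norm (g x - q x) \<le> e / (2 * P)"
    using g e P unfolding poly_limits_def by (auto dest: spec[of _ "e / (2 * P)"])
  have "norm (f x * g x - p x * q x) \<le> e" if x: "x \<in> X" for x
  proof -
    have "f x * g x - p x * q x = (f x - p x) * g x + p x * (g x - q x)" by (simp add: algebra_simps)
    also have "norm \<dots> \<le> e / (2 * G) * G + P * (e / (2 * P))"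
    proof (rule norm_triangle_mono)
      show "norm ((f x - p x) * g x) \<le> e / (2 * G) * G"
        unfolding norm_mult using x p(2) G e by (intro mult_mono) auto
      show "norm (p x * (g x - q x)) \<le> P * (e / (2 * P))"
        unfolding norm_mult using x q(2) P by (intro mult_mono) auto
    qed
    also have "\<dots> = e" using G P by simp
    finally show ?thesis .
  qed
  with p(1) q(1) show "\<exists>p. hol_poly2 p \<and> (\<forall>x\<in>X. norm (f x * g x - p x) \<le> e)"
    by (intro exI[of _ "\<lambda>x. p x * q x"]) (simp add: hol_poly2_mult)
qed

lemma poly_limits_inverse:
  assumes X: "bounded X" and f: "f \<in> poly_limits X" and q: "q < 1" "\<forall>x\<in>X. norm (1 - f x) \<le> q"
  shows "(\<lambda>x. inverse (f x)) \<in> poly_limits X"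
proof (rule poly_limits_closed)
  fix e :: real assume e: "e > 0"
  \<comment> \<open>\<open>q\<close> can be negative when \<open>X\<close> is empty.\<close>
  define r where "r = max q 0"
  have r: "0 \<le> r" "r < 1" "\<And>x. x \<in> X \<Longrightarrow> norm (1 - f x) \<le> r" using q by (auto simp: r_def le_max_iff_disj)
  have g: "(\<lambda>x. 1 - f x) \<in> poly_limits X"
    using poly_limits_add[OF hol_poly2_in_poly_limits[OF hol_poly2_const[of 1]]
        poly_limits_mult[OF X hol_poly2_in_poly_limits[OF hol_poly2_const[of "-1"]] f]] by simp
  have pow: "(\<lambda>x. (1 - f x) ^ n) \<in> poly_limits X" for n
  proof (induction n)
    case (Suc n)
    then show ?case using poly_limits_mult[OF X g Suc] by simp
  qed (simp add: hol_poly2_in_poly_limits[OF hol_poly2_const])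
  have sum: "(\<lambda>x. \<Sum>i<n. (1 - f x) ^ i) \<in> poly_limits X" for n
  proof (induction n)
    case (Suc n)
    then show ?case using poly_limits_add[OF Suc pow] by simp
  qed (simp add: hol_poly2_in_poly_limits[OF hol_poly2_const])
  obtain n where n: "r ^ n < e * (1 - r)"
    using real_arch_pow_inv[of "e * (1 - r)" r] e r by auto
  show "\<exists>g\<in>poly_limits X. \<forall>x\<in>X. norm (inverse (f x) - g x) \<le> e"
  proof (rule bexI[OF _ sum], rule ballI)
    fix x assume x: "x \<in> X"
    have fge: "norm (f x) \<ge> 1 - r" using r(3)[OF x] norm_triangle_ineq2[of 1 "1 - f x"] by simp
    then have f0: "f x \<noteq> 0" using r by auto
    have "(\<Sum>i<n. (1 - f x) ^ i) * f x = 1 - (1 - f x) ^ n"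
      using one_diff_power_eq[of "1 - f x" n] by (simp add: mult.commute)
    then have "(\<Sum>i<n. (1 - f x) ^ i) = (1 - (1 - f x) ^ n) / f x" using f0 by (simp add: field_simps)
    then have "inverse (f x) - (\<Sum>i<n. (1 - f x) ^ i) = (1 - f x) ^ n / f x"
      using f0 by (simp add: field_simps)
    then have "norm (inverse (f x) - (\<Sum>i<n. (1 - f x) ^ i)) = norm (1 - f x) ^ n / norm (f x)"
      by (simp add: norm_divide norm_power)
    also have "\<dots> \<le> r ^ n / (1 - r)"
      using fge r x by (intro frac_le power_mono) auto
    also have "\<dots> \<le> e" using n r by (simp add: field_simps)
    finally show "norm (inverse (f x) - (\<Sum>i<n. (1 - f x) ^ i)) \<le> e" .
  qed
qed

lemma function_algebra_poly_limits: "bounded X \<Longrightarrow> function_algebra X (poly_limits X)"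
proof unfold_locales
  fix f g and c :: complex
  assume X: "bounded X"
  show "(\<lambda>_. c) \<in> poly_limits X" by (intro hol_poly2_in_poly_limits hol_poly2_const)
  assume f: "f \<in> poly_limits X"
  show "\<exists>B. \<forall>x\<in>X. norm (f x) \<le> B" using poly_limits_bounded[OF X f] by blast
  show "(\<lambda>x. inverse (f x)) \<in> poly_limits X" if "q < 1" "\<forall>x\<in>X. norm (1 - f x) \<le> q" for q
    using poly_limits_inverse[OF X f that] .
  assume g: "g \<in> poly_limits X"
  show "(\<lambda>x. f x + g x) \<in> poly_limits X" "(\<lambda>x. f x * g x) \<in> poly_limits X"
    using poly_limits_add[OF f g] poly_limits_mult[OF X f g] by auto
qed

lemma MconeD:
  assumes "x \<in> Mcone"
  shows "norm (fst x) = norm (snd x)" "fst x \<noteq> 0" "snd x \<noteq> 0"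
  using assms by (auto simp: Mcone_def)

section \<open>Maximum principle on the hull, inverses of the coordinates, peaking on leaves\<close>

context
  fixes K :: "(complex \<times> complex) set"
  assumes K: "compact K" "K \<noteq> {}"
begin

text \<open>The \<open>SUP\<close> in \<open>poly_hull\<close> is a genuine supremum only over a
  bounded nonempty set of values; compactness gives the bound.\<close>

lemma bdd_above_norm_hol_poly2: "hol_poly2 p \<Longrightarrow> bdd_above ((\<lambda>x. norm (p x)) ` K)"
  by (intro bounded_imp_bdd_above compact_imp_bounded compact_continuous_image K
      continuous_intros hol_poly2_continuous_on)

lemma subset_poly_hull: "K \<subseteq> poly_hull K"
  unfolding poly_hull_def using bdd_above_norm_hol_poly2 by (auto intro!: cSUP_upper)

lemma poly_hull_bound:
  assumes "hol_poly2 p" "\<And>y. y \<in> K \<Longrightarrow> norm (p y) \<le> c" "x \<in> poly_hull K"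
  shows "norm (p x) \<le> c"
proof -
  have "norm (p x) \<le> (SUP y\<in>K. norm (p y))" using assms unfolding poly_hull_def by blast
  also have "\<dots> \<le> c" using assms K by (intro cSUP_least) auto
  finally show ?thesis .
qed

lemma bounded_poly_hull: "bounded (poly_hull K)"
proof -
  obtain B where B: "\<And>x. x \<in> K \<Longrightarrow> norm x \<le> B"
    using compact_imp_bounded[OF K(1)] bounded_iff by blast
  have "norm x \<le> B + B" if x: "x \<in> poly_hull K" for x
  proof -
    have "norm (fst x) \<le> B"
      by (rule poly_hull_bound[OF hol_poly2_fst _ x])
         (metis B norm_fst_le order_trans prod.collapse)
    moreover have "norm (snd x) \<le> B"
      by (rule poly_hull_bound[OF hol_poly2_snd _ x])
         (metis B norm_snd_le order_trans prod.collapse)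
    ultimately show ?thesis using norm_Pair_le[of "fst x" "snd x"] by simp
  qed
  then show ?thesis unfolding bounded_iff by blast
qed

interpretation function_algebra "poly_hull K" "poly_limits (poly_hull K)"
  by (rule function_algebra_poly_limits[OF bounded_poly_hull])

text \<open>The defining inequality of the hull survives uniform limits; it will be applied to
  quotients such as \<open>z / w\<close>, which are not polynomials.\<close>

lemma poly_hull_bound_limits:
  assumes f: "f \<in> poly_limits (poly_hull K)" and c: "\<And>y. y \<in> K \<Longrightarrow> norm (f y) \<le> c"
    and x: "x \<in> poly_hull K"
  shows "norm (f x) \<le> c"
proof (rule field_le_epsilon)
  fix e :: real assume e: "e > 0"
  obtain p where p: "hol_poly2 p" "\<forall>x\<in>poly_hull K. norm (f x - p x) \<le> e / 2"
    using f e unfolding poly_limits_def by (auto dest: spec[of _ "e / 2"])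
  have "norm (p y) \<le> c + e / 2" if "y \<in> K" for y
  proof -
    have "norm (f y - p y) \<le> e / 2" using p(2) that subset_poly_hull by blast
    then show ?thesis using c[OF that] norm_triangle_ineq2[of "p y" "f y"] norm_minus_commute[of "f y" "p y"]
      by linarith
  qed
  then have "norm (p x) \<le> c + e / 2" by (rule poly_hull_bound[OF p(1) _ x])
  moreover have "norm (f x - p x) \<le> e / 2" using p(2) x by blast
  ultimately show "norm (f x) \<le> c + e" using norm_triangle_ineq2[of "f x" "p x"] by linarith
qed

text \<open>A polynomial \<open>p\<close> that is larger at \<open>y\<close> than on the hull gives
  \<open>f = 1 - p / p y\<close>, a unit by \<open>neumann\<close> that vanishes at
  \<open>y\<close>. Hence \<open>f\<close> lies in the ideal of the two coordinate differences, and
  dividing by \<open>f\<close> shows that this ideal contains 1.\<close>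

lemma comaximal_off_poly_hull:
  assumes "y \<notin> poly_hull K"
  shows "\<exists>a\<in>poly_limits (poly_hull K). \<exists>b\<in>poly_limits (poly_hull K).
    \<forall>x\<in>poly_hull K. a x * (snd x - snd y) + b x * (fst x - fst y) = 1"
proof -
  obtain p where p: "hol_poly2 p" "norm (p y) > (SUP x\<in>K. norm (p x))"
    using assms unfolding poly_hull_def by force
  define s where "s = (SUP x\<in>K. norm (p x))"
  have s: "norm (p x) \<le> s" if "x \<in> poly_hull K" for x
    using that p(1) unfolding poly_hull_def s_def by blast
  have s0: "s \<ge> 0" using K(2) subset_poly_hull s norm_ge_zero order_trans by (metis ex_in_conv subsetD)
  have py: "norm (p y) > s" "p y \<noteq> 0" using p(2) s0 by (auto simp: s_def[symmetric])
  obtain g h where gh: "hol_poly2 g" "hol_poly2 h"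
    "\<And>x. p x - p y = (fst x - fst y) * g x + (snd x - snd y) * h x"
    using hol_poly2_diff_eq[OF p(1), of y] by blast
  define f where "f = (\<lambda>x. (- 1 / p y) * (p x - p y))"
  have f_eq: "1 - f x = p x / p y" for x using py by (simp add: f_def field_simps)
  have fA: "f \<in> poly_limits (poly_hull K)" unfolding f_def
    by (intro hol_poly2_in_poly_limits hol_poly2_mult hol_poly2_diff hol_poly2_const p)
  have q: "s / norm (p y) < 1" using py s0 by (simp add: field_simps)
  have le: "\<forall>x\<in>poly_hull K. norm (1 - f x) \<le> s / norm (p y)"
    using s by (simp add: f_eq norm_divide divide_right_mono)
  have iA: "(\<lambda>x. inverse (f x)) \<in> poly_limits (poly_hull K)"
    using neumann[OF fA q le] .
  have f0: "f x \<noteq> 0" if "x \<in> poly_hull K" for x using le that q by force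
  define a where "a = (\<lambda>x. (- 1 / p y) * (h x * inverse (f x)))"
  define b where "b = (\<lambda>x. (- 1 / p y) * (g x * inverse (f x)))"
  have ab: "a \<in> poly_limits (poly_hull K)" "b \<in> poly_limits (poly_hull K)"
    unfolding a_def b_def by (intro mult const iA hol_poly2_in_poly_limits gh)+
  have "a x * (snd x - snd y) + b x * (fst x - fst y) = 1" if x: "x \<in> poly_hull K" for x
  proof -
    have "a x * (snd x - snd y) + b x * (fst x - fst y)
      = ((- 1 / p y) * ((fst x - fst y) * g x + (snd x - snd y) * h x)) * inverse (f x)"
      unfolding a_def b_def by algebra
    also have "\<dots> = f x * inverse (f x)" by (simp only: gh(3)[symmetric] f_def)
    finally show ?thesis using f0[OF x] by simp
  qed
  with ab show ?thesis by blast
qed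

text \<open>The points \<open>(l, 0)\<close> all miss the hull, so \<open>w\<close> and
  \<open>z - l\<close> generate the unit ideal for every \<open>l\<close>, as
  \<open>invertible_if_comaximal\<close> demands. For \<open>z\<close> the roles are
  exchanged.\<close>

lemma coordinate_inverses_in_poly_limits:
  assumes "poly_hull K \<inter> {(z, w). z * w = 0} = {}"
  shows "(\<lambda>x. inverse (fst x)) \<in> poly_limits (poly_hull K)"
    and "(\<lambda>x. inverse (snd x)) \<in> poly_limits (poly_hull K)"
proof -
  let ?X = "poly_hull K" and ?A = "poly_limits (poly_hull K)"
  have ne: "?X \<noteq> {}" using K(2) subset_poly_hull by blast
  have coords: "fst \<in> ?A" "snd \<in> ?A" using hol_poly2_in_poly_limits hol_poly2_fst hol_poly2_snd by blast+
  have off: "(l, 0) \<notin> ?X" "(0, l) \<notin> ?X" for l using assms by auto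
  have "\<exists>c\<in>?A. \<forall>x\<in>?X. c x * snd x = 1"
    by (rule invertible_if_comaximal[OF ne coords(1)])
       (use comaximal_off_poly_hull[OF off(1)] in simp)
  then obtain c where c: "c \<in> ?A" "\<And>x. x \<in> ?X \<Longrightarrow> c x * snd x = 1" by blast
  show "(\<lambda>x. inverse (snd x)) \<in> ?A"
    by (rule poly_limits_cong[OF c(1)]) (use c(2) in \<open>metis inverse_unique mult.commute\<close>)
  have "\<exists>c\<in>?A. \<forall>x\<in>?X. c x * fst x = 1"
    by (rule invertible_if_comaximal[OF ne coords(2)])
       (use comaximal_off_poly_hull[OF off(2)] in \<open>simp add: add.commute; blast\<close>)
  then obtain c where c: "c \<in> ?A" "\<And>x. x \<in> ?X \<Longrightarrow> c x * fst x = 1" by blast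
  show "(\<lambda>x. inverse (fst x)) \<in> ?A"
    by (rule poly_limits_cong[OF c(1)]) (use c(2) in \<open>metis inverse_unique mult.commute\<close>)
qed

lemma norm_eq_on_poly_hull:
  assumes "K \<subseteq> Mcone" and miss: "poly_hull K \<inter> {(z, w). z * w = 0} = {}" and x: "x \<in> poly_hull K"
  shows "norm (fst x) = norm (snd x)"
proof -
  note inv = coordinate_inverses_in_poly_limits[OF miss]
  have nz: "fst x \<noteq> 0" "snd x \<noteq> 0" using miss x by (cases x; auto simp: disjoint_iff)+
  have K': "norm (fst y * inverse (snd y)) \<le> 1" "norm (snd y * inverse (fst y)) \<le> 1" if "y \<in> K" for y
    using MconeD[of y] assms(1) that by (auto simp: norm_mult norm_inverse)
  have "norm (fst x * inverse (snd x)) \<le> 1"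
    by (rule poly_hull_bound_limits[OF mult[OF hol_poly2_in_poly_limits[OF hol_poly2_fst] inv(2)] K'(1) x])
  moreover have "norm (snd x * inverse (fst x)) \<le> 1"
    by (rule poly_hull_bound_limits[OF mult[OF hol_poly2_in_poly_limits[OF hol_poly2_snd] inv(1)] K'(2) x])
  ultimately have "norm (fst x) \<le> norm (snd x)" "norm (snd x) \<le> norm (fst x)"
    using nz by (simp_all add: norm_mult norm_inverse norm_divide pos_divide_le_eq divide_inverse[symmetric])
  then show ?thesis by (rule antisym)
qed

text \<open>The function \<open>(1 + z/(t w))/2\<close> peaks exactly on the leaf \<open>z = t w\<close>, so the hull of \<open>K\<close>
  is formed leaf by leaf.\<close>
lemma poly_hull_leaf_bound:
  assumes M: "K \<subseteq> Mcone" and miss: "poly_hull K \<inter> {(z, w). z * w = 0} = {}"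
    and x0: "x0 \<in> poly_hull K" and t: "fst x0 = t * snd x0" "norm t = 1"
    and p: "hol_poly2 p" and le: "\<And>x. x \<in> K \<Longrightarrow> fst x = t * snd x \<Longrightarrow> norm (p x) \<le> 1 / 2"
  shows "norm (p x0) < 1"
proof -
  note inv = coordinate_inverses_in_poly_limits[OF miss]
  define h where "h = (\<lambda>x::complex \<times> complex. (1 / 2) * (1 + inverse t * (fst x * inverse (snd x))))"
  have hA: "h \<in> poly_limits (poly_hull K)" unfolding h_def
    by (intro mult add const inv hol_poly2_in_poly_limits hol_poly2_fst)
  have t0: "t \<noteq> 0" using t(2) by auto
  have w0: "snd x0 \<noteq> 0" using miss x0 by (cases x0) (auto simp: disjoint_iff)
  have "inverse t * (fst x0 * inverse (snd x0)) = (inverse t * t) * (snd x0 * inverse (snd x0))"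
    unfolding t(1) by (simp only: mult.assoc)
  also have "\<dots> = 1" using w0 t0 by simp
  finally have h0: "h x0 = 1" by (simp only: h_def) simp
  have nz: "snd x \<noteq> 0" if "x \<in> K" for x using MconeD(3) M that by blast
  define s where "s = (\<lambda>x::complex \<times> complex. inverse t * (fst x * inverse (snd x)))"
  have s1: "norm (s x) = 1" if "x \<in> K" for x
    using MconeD[of x] M that t(2) by (auto simp: s_def norm_mult norm_inverse)
  have hs: "h x = (1 + s x) / 2" for x by (simp add: h_def s_def)
  have h1: "norm (h x) \<le> 1" if "x \<in> K" for x
    using s1[OF that] norm_triangle_ineq[of 1 "s x"] by (simp add: hs norm_divide)
  have h_less: "norm (h x) < 1" if x: "x \<in> K" and leaf: "fst x \<noteq> t * snd x" for x
  proof -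
    \<comment> \<open>Equality in the triangle inequality would force the unimodular number
      \<open>s x\<close> to be 1, that is, \<open>x\<close> to lie on the leaf.\<close>
    have "norm (1 + s x) \<noteq> norm (1::complex) + norm (s x)"
    proof
      assume "norm (1 + s x) = norm (1::complex) + norm (s x)"
      then have "norm (1::complex) *\<^sub>R s x = norm (s x) *\<^sub>R 1" by (simp only: norm_triangle_eq)
      then have "s x = 1" using s1[OF x] by simp
      then show False using leaf nz[OF x] t0 by (simp add: s_def field_simps)
    qed
    then have "norm (1 + s x) < 2" using norm_triangle_ineq[of 1 "s x"] s1[OF x] by simp
    then show ?thesis by (simp add: hs norm_divide)
  qed
  have cont_h: "continuous_on K h" unfolding h_def
    by (intro continuous_intros) (use nz in auto)
  \<comment> \<open>The threshold 3/4 lies strictly between 1/2 and 1: \<open>F\<close> avoids the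
    leaf, so by compactness \<open>norm (h x)\<close> is bounded there by some
    \<open>q < 1\<close>.\<close>
  define F where "F = K \<inter> {x. norm (p x) \<ge> 3 / 4}"
  have "compact F" unfolding F_def
    by (intro compact_Int_closed K closed_Collect_le continuous_intros hol_poly2_continuous_on p)
  have F_less: "norm (h x) < 1" if "x \<in> F" for x
    using that le[of x] by (intro h_less) (auto simp: F_def)
  obtain q where q: "0 \<le> q" "q < 1" "\<And>x. x \<in> F \<Longrightarrow> norm (h x) \<le> q"
  proof (cases "F = {}")
    case False
    have "continuous_on F (\<lambda>x. norm (h x))"
      by (intro continuous_intros continuous_on_subset[OF cont_h]) (auto simp: F_def)
    then obtain m where "m \<in> F" "\<And>x. x \<in> F \<Longrightarrow> norm (h x) \<le> norm (h m)"
      using continuous_attains_sup[OF \<open>compact F\<close> False] by blast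
    then show ?thesis using that[of "norm (h m)"] F_less by auto
  qed (use that[of 0] in auto)
  obtain B where B: "B > 0" "\<And>x. x \<in> K \<Longrightarrow> norm (p x) \<le> B"
    using poly_limits_bounded[OF compact_imp_bounded[OF K(1)] hol_poly2_in_poly_limits[OF p]] by blast
  \<comment> \<open>The power makes \<open>p * h ^ n\<close> small on \<open>F\<close>; off
    \<open>F\<close> the bound 1 for \<open>h\<close> suffices, and at \<open>x0\<close> the power
    is 1.\<close>
  obtain n where n: "q ^ n < 3 / 4 / B"
    using real_arch_pow_inv[of "3 / 4 / B" q] q B by auto
  have small: "norm (p x * h x ^ n) \<le> 3 / 4" if x: "x \<in> K" for x
  proof (cases "x \<in> F")
    case True
    have "norm (p x * h x ^ n) \<le> B * q ^ n"
      unfolding norm_mult norm_power using B x q(1) q(3)[OF True] by (intro mult_mono power_mono) auto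
    also have "\<dots> \<le> 3 / 4" using n B by (simp add: field_simps)
    finally show ?thesis .
  next
    case False
    then have "norm (p x) \<le> 3 / 4" using x by (auto simp: F_def)
    moreover have "norm (h x) ^ n \<le> 1" using h1[OF x] by (intro power_le_one) auto
    ultimately show ?thesis unfolding norm_mult norm_power
      using mult_mono[of "norm (p x)" "3 / 4" "norm (h x) ^ n" 1] by simp
  qed
  have "norm (p x0 * h x0 ^ n) \<le> 3 / 4"
    by (rule poly_hull_bound_limits[OF mult[OF hol_poly2_in_poly_limits[OF p] power[OF hA]] small x0])
  then show ?thesis by (simp add: h0)
qed

end

section \<open>Runge approximation in a leaf by moving poles\<close>

text \<open>With \<open>w\<close> for \<open>snd x\<close>, \<open>w - b\<close> equals
  \<open>(w - a) * (1 - (b - a) / (w - a))\<close>, and the second factor is within 1/2 of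
  1.\<close>

lemma pole_shift:
  assumes X: "bounded X" and a: "(\<lambda>x. inverse (snd x - a)) \<in> poly_limits X"
    and le: "\<And>x. x \<in> X \<Longrightarrow> 2 * norm (b - a) \<le> norm (snd x - a)" "\<And>x. x \<in> X \<Longrightarrow> snd x \<noteq> a"
  shows "(\<lambda>x. inverse (snd x - b)) \<in> poly_limits X"
proof -
  interpret function_algebra X "poly_limits X" by (rule function_algebra_poly_limits[OF X])
  define f where "f = (\<lambda>x::complex \<times> complex. 1 - (b - a) * inverse (snd x - a))"
  have fA: "f \<in> poly_limits X" unfolding f_def by (intro diff mult const a)
  have "norm (1 - f x) \<le> 1 / 2" if "x \<in> X" for x
    using le[OF that] by (simp add: f_def norm_divide pos_divide_le_eq divide_inverse[symmetric])
  then have iA: "(\<lambda>x. inverse (f x)) \<in> poly_limits X" using neumann[OF fA, of "1 / 2"] by simp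
  have "(\<lambda>x. inverse (snd x - a) * inverse (f x)) \<in> poly_limits X" by (intro mult a iA)
  then show ?thesis
  proof (rule poly_limits_cong)
    fix x assume x: "x \<in> X"
    have "(snd x - a) * f x = snd x - b" using le(2)[OF x] by (simp add: f_def field_simps)
    then show "inverse (snd x - b) = inverse (snd x - a) * inverse (f x)"
      by (simp flip: inverse_mult_distrib)
  qed
qed

text \<open>The admissible poles form a set that is open and closed relative to the connected
  complement of the projection \<open>E\<close>; it contains a point far away, where a geometric
  series applies.\<close>

lemma pole_in_poly_limits:
  assumes X: "compact X" and con: "connected (- snd ` X)" and a: "a \<notin> snd ` X"
  shows "(\<lambda>x. inverse (snd x - a)) \<in> poly_limits X"
proof -
  have bX: "bounded X" using X by (rule compact_imp_bounded)
  interpret function_algebra X "poly_limits X" by (rule function_algebra_poly_limits[OF bX])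
  define E where "E = snd ` X"
  have E: "snd x \<in> E" if "x \<in> X" for x using that by (simp add: E_def)
  have cE: "compact E" unfolding E_def by (intro compact_continuous_image X continuous_intros)
  have conE: "connected (- E)" and aE: "a \<notin> E" using con a by (simp_all add: E_def)
  define S where "S = {a. a \<notin> E \<and> (\<lambda>x. inverse (snd x - a)) \<in> poly_limits X}"
  have step: "\<exists>d>0. \<forall>b. dist b a < d \<longrightarrow> b \<notin> E \<and> (b \<in> S \<longleftrightarrow> a \<in> S)" if a: "a \<notin> E" for a
  proof -
    have "open (- E)" using cE by (simp add: compact_imp_closed open_Compl)
    then obtain d where d: "d > 0" "ball a d \<subseteq> - E"
      by (rule openE[where x = a]) (use a in simp)
    have far: "norm (snd x - a) \<ge> d" if "x \<in> X" for x
    proof (rule ccontr)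
      assume "\<not> ?thesis"
      then have "snd x \<in> ball a d" by (simp add: dist_norm norm_minus_commute)
      then have "snd x \<in> - E" using d(2) by blast
      then show False using E[OF that] by simp
    qed
    \<comment> \<open>Distance below \<open>d / 4\<close> keeps \<open>b\<close> at least
      \<open>3 * d / 4\<close> away from \<open>E\<close>, so that \<open>pole_shift\<close> applies
      in both directions.\<close>
    have near: "b \<notin> E \<and> (b \<in> S \<longleftrightarrow> a \<in> S)" if b: "dist b a < d / 4" for b
    proof -
      have bE: "b \<notin> E" 
      proof -
        have "b \<in> ball a d" using b d(1) by (simp add: dist_commute)
        then show ?thesis using d(2) by blast
      qed
      have ba: "norm (b - a) < d / 4" "norm (a - b) < d / 4"
        using b by (auto simp: dist_norm norm_minus_commute)
      have farb: "2 * norm (a - b) \<le> norm (snd x - b)" if "x \<in> X" for x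
      proof -
        have "norm (snd x - b) \<ge> norm (snd x - a) - norm (b - a)"
          using norm_triangle_ineq2[of "snd x - a" "b - a"] by simp
        then show ?thesis using far[OF that] ba d(1) by linarith
      qed
      have fara: "2 * norm (b - a) \<le> norm (snd x - a)" if "x \<in> X" for x
        using far[OF that] ba d(1) by simp
      have na: "snd x \<noteq> a" "snd x \<noteq> b" if "x \<in> X" for x using a bE E[OF that] by auto
      have "a \<in> S \<Longrightarrow> b \<in> S"
        using pole_shift[OF bX, of a b, OF _ fara na(1)] bE by (simp add: S_def)
      moreover have "b \<in> S \<Longrightarrow> a \<in> S"
        using pole_shift[OF bX, of b a, OF _ farb na(2)] a by (simp add: S_def)
      ultimately show ?thesis using bE by metis
    qed
    show ?thesis
    proof (intro exI conjI allI impI)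
      show "0 < d / 4" using d(1) by simp
    qed (use near in simp_all)
  qed
  have oS: "open S" unfolding open_dist
  proof
    fix a assume a: "a \<in> S"
    then have "a \<notin> E" by (simp add: S_def)
    from step[OF this] show "\<exists>e>0. \<forall>y. dist y a < e \<longrightarrow> y \<in> S" using a by metis
  qed
  have oT: "open (- E - S)" unfolding open_dist
  proof
    fix a assume a: "a \<in> - E - S"
    then have "a \<notin> E" by simp
    from step[OF this] show "\<exists>e>0. \<forall>y. dist y a < e \<longrightarrow> y \<in> - E - S" using a by (metis Compl_iff Diff_iff)
  qed
  obtain B where B: "B > 0" "\<forall>x\<in>X. norm (snd x) \<le> B"
    using poly_limits_bounded[OF bX hol_poly2_in_poly_limits[OF hol_poly2_snd]] by blast
  \<comment> \<open>Twice a bound for \<open>snd\<close> on \<open>X\<close>, so that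
    \<open>norm (snd x / b) \<le> 1 / 2\<close>.\<close>
  have "norm (of_real (2 * B) :: complex) = 2 * B" unfolding norm_of_real using B(1) by simp
  then obtain b :: complex where nb: "norm b = 2 * B" by blast
  have far_S: "b \<in> S"
  proof -
    have b0: "b \<noteq> 0" using B(1) nb by force
    define f where "f = (\<lambda>x::complex \<times> complex. 1 - inverse b * snd x)"
    have fA: "f \<in> poly_limits X"
      unfolding f_def by (intro diff mult const hol_poly2_in_poly_limits hol_poly2_snd)
    have "norm (1 - f x) \<le> 1 / 2" if "x \<in> X" for x
    proof -
      have "norm (1 - f x) = norm (snd x) / norm b" by (simp add: f_def norm_divide divide_inverse[symmetric] mult.commute[of "inverse b"])
      also have "\<dots> \<le> 1 / 2" using B that by (simp add: nb pos_divide_le_eq)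
      finally show ?thesis .
    qed
    then have iA: "(\<lambda>x. inverse (f x)) \<in> poly_limits X" using neumann[OF fA, of "1 / 2"] by simp
    have "(\<lambda>x. (- inverse b) * inverse (f x)) \<in> poly_limits X" by (intro mult const iA)
    then have "(\<lambda>x. inverse (snd x - b)) \<in> poly_limits X"
    proof (rule poly_limits_cong)
      fix x assume x: "x \<in> X"
      have "- b * (1 - c * d) = (b * c) * d - b" for c d :: complex by (simp add: algebra_simps)
      then have "- b * f x = (b * inverse b) * snd x - b" unfolding f_def .
      also have "\<dots> = snd x - b" using b0 by simp
      finally have "inverse (snd x - b) = inverse (- b * f x)" by (rule arg_cong[OF sym])
      also have "\<dots> = inverse (- b) * inverse (f x)" by (rule inverse_mult_distrib)
      finally show "inverse (snd x - b) = (- inverse b) * inverse (f x)" by (simp only: inverse_minus_eq)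
    qed
    moreover have "b \<notin> E" 
    proof
      assume "b \<in> E"
      then obtain x where "x \<in> X" "b = snd x" unfolding E_def by blast
      then show False using B nb by force
    qed
    ultimately show ?thesis by (simp add: S_def)
  qed
  have "S \<inter> - E = {} \<or> (- E - S) \<inter> - E = {}"
    by (rule connectedD[OF conE oS oT]) auto
  moreover have "b \<in> S \<inter> - E" using far_S by (simp add: S_def)
  ultimately have "a \<in> S" using aE by blast
  then show ?thesis by (simp add: S_def)
qed

text \<open>A hull point \<open>x0\<close> off \<open>K\<close> lies on a leaf and is determined
  there by \<open>snd x0\<close>, which is thus off the projection of that part of \<open>K\<close>.
  A polynomial \<open>q\<close> close to \<open>1 / (w - snd x0)\<close> on this part gives
  \<open>p = 1 - (w - snd x0) * q\<close>, small there but equal to 1 at \<open>x0\<close>, against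
  \<open>poly_hull_leaf_bound\<close>.\<close>

proposition poly_convex_if_leaves_nonseparating:
  assumes K: "compact K" "K \<noteq> {}" and M: "K \<subseteq> Mcone"
    and miss: "poly_hull K \<inter> {(z, w). z * w = 0} = {}"
    and con: "\<And>t. norm t = 1 \<Longrightarrow> connected (- snd ` {x \<in> K. fst x = t * snd x})"
  shows "poly_convex K"
proof -
  have "x0 \<in> K" if x0: "x0 \<in> poly_hull K" for x0
  proof (rule ccontr)
    assume notK: "x0 \<notin> K"
    define t where "t = fst x0 / snd x0"
    have nz: "fst x0 \<noteq> 0" "snd x0 \<noteq> 0" using miss x0 by (cases x0; auto simp: disjoint_iff)+
    have t: "fst x0 = t * snd x0" "norm t = 1"
      using nz norm_eq_on_poly_hull[OF K M miss x0] by (auto simp: t_def norm_divide)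
    let ?L = "{x \<in> K. fst x = t * snd x}"
    have "closed {x :: complex \<times> complex. fst x = t * snd x}"
      by (intro closed_Collect_eq continuous_intros)
    then have "compact (K \<inter> {x. fst x = t * snd x})" by (rule compact_Int_closed[OF K(1)])
    moreover have "K \<inter> {x. fst x = t * snd x} = ?L" by blast
    ultimately have L: "compact ?L" by (rule back_subst)
    have off: "snd x \<noteq> snd x0" if "x \<in> ?L" for x
    proof
      assume "snd x = snd x0"
      then have "x = x0" using that t(1) by (intro prod_eqI) auto
      then show False using that notK by blast
    qed
    have "snd x0 \<notin> snd ` ?L"
    proof
      assume "snd x0 \<in> snd ` ?L"
      then obtain x where x: "snd x0 = snd x" "x \<in> ?L" by (rule imageE)
      show False by (rule notE[OF off[OF x(2)] x(1)[symmetric]])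
    qed
    note inv = pole_in_poly_limits[OF L con[OF t(2)] this]
    have "(\<lambda>x. snd x - snd x0) \<in> poly_limits ?L"
      by (intro hol_poly2_in_poly_limits hol_poly2_diff hol_poly2_snd hol_poly2_const)
    then obtain B where B: "B > 0" "\<forall>x\<in>?L. norm (snd x - snd x0) \<le> B"
      using poly_limits_bounded[OF compact_imp_bounded[OF L]] by blast
    obtain q where q: "hol_poly2 q" "\<forall>x\<in>?L. norm (inverse (snd x - snd x0) - q x) \<le> 1 / 2 / B"
      using inv B(1) unfolding poly_limits_def by (auto dest: spec[of _ "1 / 2 / B"])
    define p where "p = (\<lambda>x. 1 - (snd x - snd x0) * q x)"
    have p: "hol_poly2 p" unfolding p_def
      by (intro hol_poly2_diff hol_poly2_mult hol_poly2_snd hol_poly2_const q)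
    have "norm (p x) \<le> 1 / 2" if x: "x \<in> ?L" for x
    proof -
      have "p x = (snd x - snd x0) * (inverse (snd x - snd x0) - q x)"
        using off[OF x] by (simp add: p_def right_diff_distrib)
      also have "norm \<dots> \<le> B * (1 / 2 / B)"
        unfolding norm_mult
        using bspec[OF B(2) x] bspec[OF q(2) x] B(1) by (intro mult_mono) simp_all
      finally show ?thesis using B by simp
    qed
    then have "norm (p x0) < 1"
      by (intro poly_hull_leaf_bound[OF K M miss x0 t p]) auto
    then show False by (simp add: p_def)
  qed
  then show ?thesis using subset_poly_hull[OF K] unfolding poly_convex_def by blast
qed

section \<open>Leaves of a totally real disc\<close>

text \<open>A bounded component \<open>U\<close> of the complement lies in \<open>D\<close> and has
  its frontier in \<open>C\<close>. The extrema of \<open>\<theta>\<close> on the closure of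
  \<open>U\<close> are not attained in \<open>U\<close>, so both equal \<open>c\<close>; but then
  \<open>\<theta>\<close> is constant on \<open>U\<close> and every point of \<open>U\<close> is an
  extremum.\<close>

lemma level_continuum_nonseparating:
  fixes D C :: "'a::euclidean_space set" and \<theta> :: "'a \<Rightarrow> real"
  assumes dim: "2 \<le> DIM('a)" and D: "compact D" "convex D" and C: "closed C" "C \<subseteq> D"
    and cont: "continuous_on D \<theta>" and const: "\<And>x. x \<in> C \<Longrightarrow> \<theta> x = c"
    and no_extremum: "\<And>V x. \<lbrakk>open V; x \<in> V; V \<subseteq> D; (\<forall>y\<in>V. \<theta> y \<le> \<theta> x) \<or> (\<forall>y\<in>V. \<theta> x \<le> \<theta> y)\<rbrakk> \<Longrightarrow> False"
  shows "connected (- C)"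
proof (rule ccontr)
  assume "\<not> connected (- C)"
  moreover have "bounded (- (- C))"
    using D(1) C(2) bounded_subset compact_imp_bounded by auto
  ultimately obtain U where U: "U \<in> components (- C)" "bounded U"
    using cobounded_has_bounded_component dim by blast
  have oU: "open U" using open_components[OF _ U(1)] C(1) by (simp add: open_Compl)
  have neU: "U \<noteq> {}" using U(1) by (rule in_components_nonempty)
  \<comment> \<open>Otherwise the connected set \<open>- D\<close>, which avoids \<open>C\<close>,
    would lie in the bounded set \<open>U\<close>.\<close>
  have UD: "U \<subseteq> D"
  proof (rule ccontr)
    assume "\<not> U \<subseteq> D"
    then have "U \<inter> - D \<noteq> {}" by blast
    moreover have "connected (- D)"
      by (rule connected_complement_bounded_convex[OF compact_imp_bounded[OF D(1)] D(2) dim])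
    moreover have "- D \<subseteq> - C" using C(2) by (rule compl_mono)
    ultimately have "- D \<subseteq> U" using components_maximal[OF U(1)] by simp
    then have "bounded (- D)" using U(2) bounded_subset by blast
    then have "bounded (- D \<union> D)" using compact_imp_bounded[OF D(1)] by (simp only: bounded_Un)
    moreover have "- D \<union> D = UNIV" by (rule Compl_partition2)
    ultimately show False using not_bounded_UNIV by metis
  qed
  have frU: "closure U \<subseteq> U \<union> C"
    using frontier_of_components_closed_complement[OF C(1) U(1)] closure_Un_frontier[of U] by blast
  have "closure U \<subseteq> D" using UD D(1) by (meson closure_minimal compact_imp_closed)
  then have contU: "continuous_on (closure U) \<theta>" using cont continuous_on_subset by blast
  have cU: "compact (closure U)" using U(2) by (simp add: compact_closure)
  have ne: "closure U \<noteq> {}" using neU by simp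
  obtain M where M: "M \<in> closure U" "\<And>y. y \<in> closure U \<Longrightarrow> \<theta> y \<le> \<theta> M"
    using continuous_attains_sup[OF cU ne contU] by blast
  obtain m where m: "m \<in> closure U" "\<And>y. y \<in> closure U \<Longrightarrow> \<theta> m \<le> \<theta> y"
    using continuous_attains_inf[OF cU ne contU] by blast
  have sub: "y \<in> closure U" if "y \<in> U" for y using that closure_subset by blast
  have "M \<notin> U" using no_extremum[OF oU _ UD, of M] M(2) sub by blast
  moreover have "m \<notin> U" using no_extremum[OF oU _ UD, of m] m(2) sub by blast
  ultimately have "\<theta> M = c" "\<theta> m = c" using M(1) m(1) frU const by blast+
  then have "\<theta> y = c" if "y \<in> U" for y using M(2) m(2) sub[OF that] by (metis order_antisym)
  moreover obtain x where "x \<in> U" using neU by blast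
  ultimately show False using no_extremum[OF oU _ UD, of x] by simp
qed

text \<open>A compact plane set does not separate the plane iff it is Borsukian, i.e. every
  continuous map from it to the punctured plane is nullhomotopic; this is intrinsic to the set. The
  linear map \<open>f\<close> carries \<open>real^2\<close> to \<open>complex\<close>, where the
  criterion is stated.\<close>

lemma nonseparating_homeomorphic:
  fixes S :: "complex set" and T :: "(real^2) set"
  assumes S: "compact S" and T: "compact T" and hom: "T homeomorphic S" and con: "connected (- T)"
  shows "connected (- S)"
proof -
  have dims: "DIM(real^2) = DIM(complex)" by simp
  obtain f :: "real^2 \<Rightarrow> complex" and g where fg: "linear f" "linear g" "\<And>x. g (f x) = x" "\<And>y. f (g y) = y"
    using isomorphisms_UNIV_UNIV[OF dims] by metis
  have inj: "inj f" using fg(3) by (rule inj_on_inverseI)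
  have "f ` (- T) = - f ` T" using fg(3,4) by (intro bij_image_Compl_eq bijI inj surjI)
  moreover have "connected (f ` (- T))"
    by (rule connected_continuous_image[OF linear_continuous_on con]) (simp add: fg linear_linear)
  ultimately have "connected (- f ` T)" by simp
  moreover have "compact (f ` T)"
    by (rule compact_continuous_image[OF linear_continuous_on T]) (simp add: fg linear_linear)
  ultimately have "Borsukian (f ` T)" using Borsukian_separation_compact by blast
  moreover have "f ` T homeomorphic S"
    using hom linear_homeomorphic_image[OF fg(1) inj] homeomorphic_sym homeomorphic_trans by blast
  ultimately have "Borsukian S" by (rule homeomorphic_Borsukian)
  then show ?thesis using Borsukian_separation_compact[OF S] by blast
qed

section \<open>Tangent planes of the disc and extrema of the argument\<close>

text \<open>\<open>tangent_space\<close> is defined through charts of \<open>N\<close>, so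
  \<open>D x\<close> yields tangent vectors once \<open>\<phi>\<close> is itself a chart near
  \<open>x\<close>. The point is that its image is relatively open in \<open>N\<close>: read in a
  given chart, \<open>\<phi>\<close> is an injective continuous map between planar sets, and
  invariance of domain applies.\<close>

lemma chart2_of_immersion:
  assumes N: "c1_submanifold2 N" and V: "open V" "\<phi> ` V \<subseteq> N" "x \<in> V"
    and der: "\<And>y. y \<in> V \<Longrightarrow> (\<phi> has_derivative blinfun_apply (D y)) (at y)"
    and contD: "continuous_on V D" and injD: "\<And>y. y \<in> V \<Longrightarrow> inj (blinfun_apply (D y))"
    and inj: "inj_on \<phi> V"
  shows "\<exists>V' W. x \<in> W \<and> chart2 N V' W \<phi> D"
proof -
  have "\<phi> x \<in> N" using V by blast
  then obtain V1 W1 \<psi> E where V1: "\<phi> x \<in> V1" "chart2 N V1 W1 \<psi> E"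
    using N unfolding c1_submanifold2_def by blast
  then obtain \<psi>' where \<psi>': "homeomorphism W1 (N \<inter> V1) \<psi> \<psi>'" and oV1: "open V1"
    unfolding chart2_def by blast
  have cont: "continuous_on V \<phi>"
    using der V(1) by (meson has_derivative_continuous continuous_at_imp_continuous_on)
  have "open (V \<inter> \<phi> -` V1)" using continuous_open_preimage[OF cont V(1) oV1] .
  then obtain r where r: "r > 0" "cball x r \<subseteq> V \<inter> \<phi> -` V1"
    using V(3) V1(1) open_contains_cball by (metis IntI vimageI)
  define W where "W = ball x r"
  have W: "W \<subseteq> cball x r" "W \<subseteq> V \<inter> \<phi> -` V1" "open W"
    using r ball_subset_cball[of x r] by (auto simp: W_def)
  then have W: "W \<subseteq> cball x r" "W \<subseteq> V" "\<And>y. y \<in> W \<Longrightarrow> \<phi> y \<in> N \<inter> V1" "open W"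
    using V(2) by blast+
  have cont\<psi>': "continuous_on (N \<inter> V1) \<psi>'" using \<psi>' by (rule homeomorphism_cont2)
  have "continuous_on W (\<lambda>y. \<psi>' (\<phi> y))"
    by (rule continuous_on_compose2[OF cont\<psi>' continuous_on_subset[OF cont W(2)]]) (use W(3) in blast)
  moreover have injW: "inj_on (\<lambda>y. \<psi>' (\<phi> y)) W"
  proof (rule inj_onI)
    fix y z assume yz: "y \<in> W" "z \<in> W" "\<psi>' (\<phi> y) = \<psi>' (\<phi> z)"
    have "\<phi> y = \<psi> (\<psi>' (\<phi> y))" "\<phi> z = \<psi> (\<psi>' (\<phi> z))"
      using homeomorphism_apply2[OF \<psi>'] W(3) yz by metis+
    then show "y = z" using yz inj W(2) by (metis inj_onD subsetD)
  qed
  ultimately have oQ: "open ((\<lambda>y. \<psi>' (\<phi> y)) ` W)" using invariance_of_domain W(4) by blast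
  have img: "\<phi> ` W = (N \<inter> V1) \<inter> \<psi>' -` ((\<lambda>y. \<psi>' (\<phi> y)) ` W)"
  proof (intro equalityI subsetI)
    fix q assume q: "q \<in> (N \<inter> V1) \<inter> \<psi>' -` ((\<lambda>y. \<psi>' (\<phi> y)) ` W)"
    then obtain y where y: "y \<in> W" "\<psi>' q = \<psi>' (\<phi> y)" by auto
    then have "q = \<phi> y" using homeomorphism_apply2[OF \<psi>'] W(3) q by (metis IntD1)
    then show "q \<in> \<phi> ` W" using y by blast
  qed (use W(3) in auto)
  have "openin (top_of_set (N \<inter> V1)) (\<phi> ` W)"
    unfolding img by (rule continuous_openin_preimage_gen[OF cont\<psi>' oQ])
  then obtain T where T: "open T" "\<phi> ` W = (N \<inter> V1) \<inter> T" unfolding openin_open by blast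
  \<comment> \<open>On the compact ball an injective continuous map is a homeomorphism onto its
    image; this restricts to \<open>W\<close>.\<close>
  have cont_r: "continuous_on (cball x r) \<phi>" "inj_on \<phi> (cball x r)"
    using r(2) continuous_on_subset[OF cont] inj_on_subset[OF inj] by simp_all
  obtain h where "homeomorphism (cball x r) (\<phi> ` cball x r) \<phi> h"
    using homeomorphism_compact[OF compact_cball cont_r(1) refl cont_r(2)] by blast
  then have "homeomorphism W (N \<inter> (V1 \<inter> T)) \<phi> h"
    by (rule homeomorphism_of_subsets[OF _ W(1) order_refl]) (simp add: T(2) Int_assoc)
  moreover have "open (V1 \<inter> T)" using oV1 T(1) by blast
  ultimately have "chart2 N (V1 \<inter> T) W \<phi> D"
    unfolding chart2_def using W(2,4) der injD continuous_on_subset[OF contD W(2)] by blast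
  then show ?thesis using r(1) by (intro exI conjI) (auto simp: W_def)
qed

text \<open>Each tangent space of \<open>M\<close> contains exactly one complex line, the kernel of the differential
  of \<open>arg (z/w)\<close>. At a local extremum of that argument on \<open>K\<close>, the tangent plane of \<open>K\<close>
  would be this line.\<close>
lemma no_local_extremum_arg:
  fixes \<phi> :: "real^2 \<Rightarrow> complex \<times> complex"
  assumes N: "totally_real_submanifold N" and V: "open V" "\<phi> ` V \<subseteq> N" "x \<in> V"
    and der: "\<And>y. y \<in> V \<Longrightarrow> (\<phi> has_derivative blinfun_apply (D y)) (at y)"
    and contD: "continuous_on V D" and injD: "\<And>y. y \<in> V \<Longrightarrow> inj (blinfun_apply (D y))"
    and inj: "inj_on \<phi> V" and M: "\<phi> ` V \<subseteq> Mcone"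
    and h: "continuous_on V h" "\<And>y. y \<in> V \<Longrightarrow> fst (\<phi> y) / snd (\<phi> y) = exp (h y)"
    and ext: "(\<forall>y\<in>V. Im (h y) \<le> Im (h x)) \<or> (\<forall>y\<in>V. Im (h x) \<le> Im (h y))"
  shows False
proof -
  have nz: "norm (fst (\<phi> y)) = norm (snd (\<phi> y))" "fst (\<phi> y) \<noteq> 0" "snd (\<phi> y) \<noteq> 0" if "y \<in> V" for y
    using MconeD[of "\<phi> y"] M that by blast+
  have Re_h: "Re (h y) = 0" if "y \<in> V" for y
  proof -
    have "exp (Re (h y)) = norm (fst (\<phi> y) / snd (\<phi> y))" using h(2)[OF that] by simp
    also have "\<dots> = 1" using nz[OF that] by (simp add: norm_divide)
    finally show ?thesis by simp
  qed
  \<comment> \<open>\<open>h\<close> is only known to be continuous, so derivative tests are applied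
    to this differentiable quotient, rotated to have value 1 at \<open>x\<close>. Its imaginary part
    is the sine of the increment of \<open>Im (h y)\<close>.\<close>
  define F where "F y = (fst (\<phi> y) / snd (\<phi> y)) * exp (- h x)" for y
  have F: "F y = cis (Im (h y) - Im (h x))" if "y \<in> V" for y
  proof -
    have "h y - h x = \<i> * of_real (Im (h y) - Im (h x))"
      using Re_h[OF that] Re_h[OF V(3)] by (simp add: complex_eq_iff)
    then show ?thesis using h(2)[OF that] by (simp add: F_def cis_conv_exp flip: exp_add)
  qed
  have "isCont h x" using h(1) V continuous_on_eq_continuous_at by blast
  \<comment> \<open>An increment of modulus below 1, hence below pi, has the sign of its sine, so
    the extremum passes from \<open>Im (h y)\<close> to \<open>Im (F y)\<close>.\<close>
  then obtain d where d: "d > 0" "\<And>y. dist y x < d \<Longrightarrow> dist (h y) (h x) < 1"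
    unfolding continuous_at_eps_delta by (metis zero_less_one)
  define W where "W = V \<inter> ball x d"
  have W: "open W" "x \<in> W" "W \<subseteq> V" using V d(1) by (auto simp: W_def)
  have small: "\<bar>Im (h y) - Im (h x)\<bar> < 1" if "y \<in> W" for y
  proof -
    have "norm (h y - h x) < 1" using d(2)[of y] that by (auto simp: W_def dist_commute dist_norm norm_minus_commute)
    then show ?thesis using abs_Im_le_cmod[of "h y - h x"] by simp
  qed
  have sin: "(0 \<le> sin s) = (0 \<le> s)" "(sin s \<le> 0) = (s \<le> 0)" if "\<bar>s\<bar> < 1" for s :: real
  proof -
    have s: "\<bar>s\<bar> < pi" using that pi_gt3 by linarith
    have "s > 0 \<Longrightarrow> sin s > 0" using s by (intro sin_gt_zero) auto
    moreover have "s < 0 \<Longrightarrow> sin s < 0" using s sin_gt_zero[of "- s"] by simp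
    ultimately show "(0 \<le> sin s) = (0 \<le> s)" "(sin s \<le> 0) = (s \<le> 0)" by (cases s "0::real" rule: linorder_cases; force)+
  qed
  let ?d = "\<lambda>v. (fst (D x v) * snd (\<phi> x) - fst (\<phi> x) * snd (D x v)) / (snd (\<phi> x) * snd (\<phi> x)) * exp (- h x)"
  have dF: "(F has_derivative ?d) (at x)"
    unfolding F_def
    by (intro has_derivative_mult_left has_derivative_divide' has_derivative_fst has_derivative_snd der V nz(3))
  have ImF: "((\<lambda>y. Im (F y)) has_derivative (\<lambda>v. Im (?d v))) (at x)"
    using dF by (rule has_derivative_Im)
  have ReF: "((\<lambda>y. Re (F y)) has_derivative (\<lambda>v. Re (?d v))) (at x)"
    using dF by (rule has_derivative_Re)
  have Fx: "F x = 1" using F[OF V(3)] by simp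
  have "(\<forall>y\<in>W. Im (F y) \<le> Im (F x)) \<or> (\<forall>y\<in>W. Im (F x) \<le> Im (F y))"
    using ext
  proof
    assume "\<forall>y\<in>V. Im (h y) \<le> Im (h x)"
    then have "Im (F y) \<le> Im (F x)" if "y \<in> W" for y
      using sin(2)[OF small[OF that]] F[of y] W(3) that by (auto simp: Fx)
    then show ?thesis by blast
  next
    assume "\<forall>y\<in>V. Im (h x) \<le> Im (h y)"
    then have "Im (F x) \<le> Im (F y)" if "y \<in> W" for y
      using sin(1)[OF small[OF that]] F[of y] W(3) that by (auto simp: Fx)
    then show ?thesis by blast
  qed
  from differential_zero_maxmin[OF W(2,1) ImF this] have Im0: "Im (?d v) = 0" for v by meson
  \<comment> \<open>The real part is a cosine, so it has its maximum 1 at \<open>x\<close> in either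
    case.\<close>
  have "\<forall>y\<in>V. Re (F y) \<le> Re (F x)" using F Fx by simp
  then have Re0: "Re (?d v) = 0" for v using differential_zero_maxmin[OF V(3,1) ReF] by meson
  \<comment> \<open>The whole derivative of \<open>F\<close> vanishes at \<open>x\<close>, so the
    range of \<open>D x\<close> lies in the complex line spanned by \<open>\<phi> x\<close>.\<close>
  have line: "fst (D x v) * snd (\<phi> x) = fst (\<phi> x) * snd (D x v)" for v
  proof -
    have "?d v = 0" using Re0 Im0 by (simp only: complex_eq_iff zero_complex.sel)
    then show ?thesis using nz(3)[OF V(3)] by simp
  qed
  define s where "s = fst (\<phi> x) / snd (\<phi> x)"
  have s: "fst (D x v) = s * snd (D x v)" for v
    using line[of v] nz(3)[OF V(3)] by (simp add: s_def field_simps)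
  have lin: "linear (\<lambda>v. snd (D x v))"
    by (intro bounded_linear.linear bounded_linear_snd_comp blinfun.bounded_linear_right)
  have "inj (\<lambda>v. snd (D x v))"
  proof (rule injI)
    fix v w assume "snd (D x v) = snd (D x w)"
    then have "D x v = D x w" using s by (intro prod_eqI) simp_all
    then show "v = w" using injD[OF V(3)] by (simp add: inj_eq)
  qed
  have "surj (\<lambda>v. snd (D x v))"
    using lin \<open>inj (\<lambda>v. snd (D x v))\<close> by (rule linear_injective_imp_surjective) simp
  then have onto: "\<exists>v. snd (D x v) = a" for a by (metis surjD)
  \<comment> \<open>By dimension the range is the entire complex line, so it contains a vector
    together with its multiple by \<open>\<i>\<close>.\<close>
  obtain u v where uv: "snd (D x u) = 1" "snd (D x v) = \<i>" using onto by metis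
  have "c1_submanifold2 N" using N by (simp add: totally_real_submanifold_def)
  then obtain V' W' where ch: "x \<in> W'" "chart2 N V' W' \<phi> D"
    using chart2_of_immersion[OF _ V der contD injD inj] by blast
  have tan: "D x e \<in> tangent_space N (\<phi> x)" for e
    unfolding tangent_space_def using ch by blast
  have "D x v = imul2 (D x u)" using uv s[of u] s[of v] by (simp add: imul2_def prod_eq_iff)
  then have "D x v \<in> imul2 ` tangent_space N (\<phi> x)" using tan by blast
  moreover have "\<phi> x \<in> N" using V by blast
  ultimately have "D x v = 0"
    using N tan[of v] unfolding totally_real_submanifold_def by blast
  then show False using uv(2) by simp
qed

text \<open>In the disc, the part of \<open>K\<close> on the leaf is the set where
  \<open>exp (h y) = t\<close>, a union of levels of the lift \<open>h\<close>. A connected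
  component lies on one level and cannot separate; \<open>snd\<close>, injective on the leaf,
  carries this over to the image.\<close>

proposition leaf_nonseparating:
  assumes K: "totally_real_disc K" "K \<subseteq> Mcone" and t: "norm t = 1"
  shows "connected (- snd ` {x \<in> K. fst x = t * snd x})"
proof -
  obtain N U and \<phi> :: "real^2 \<Rightarrow> complex \<times> complex" and D where
    N: "totally_real_submanifold N" and U: "open U" "cball 0 1 \<subseteq> U" "\<phi> ` U \<subseteq> N"
    and der: "\<And>x. x \<in> U \<Longrightarrow> (\<phi> has_derivative blinfun_apply (D x)) (at x)"
    and contD: "continuous_on U D" and injD: "\<And>x. x \<in> U \<Longrightarrow> inj (blinfun_apply (D x))"
    and inj: "inj_on \<phi> (cball 0 1)" and K_eq: "K = \<phi> ` cball 0 1"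
    using K(1) unfolding totally_real_disc_def by blast
  let ?B = "cball 0 1 :: (real^2) set"
  have "continuous_on U \<phi>"
    using der U(1) by (meson has_derivative_continuous continuous_at_imp_continuous_on)
  then have cont: "continuous_on ?B \<phi>" using U(2) continuous_on_subset by blast
  have nz: "fst (\<phi> y) \<noteq> 0" "snd (\<phi> y) \<noteq> 0" if "y \<in> ?B" for y
    using MconeD[of "\<phi> y"] K(2) K_eq that by blast+
  have quot: "continuous_on ?B (\<lambda>y. fst (\<phi> y) / snd (\<phi> y))"
    by (intro continuous_intros cont) (use nz in auto)
  have quot_nz: "fst (\<phi> y) / snd (\<phi> y) \<noteq> 0" if "y \<in> ?B" for y
    using nz[OF that] by simp
  obtain h where h: "continuous_on ?B h" "\<And>y. y \<in> ?B \<Longrightarrow> fst (\<phi> y) / snd (\<phi> y) = exp (h y)"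
  proof (rule continuous_logarithm_on_cball[OF quot quot_nz])
    fix h assume "continuous_on ?B h" "\<And>y. y \<in> ?B \<Longrightarrow> fst (\<phi> y) / snd (\<phi> y) = exp (h y)"
    then show thesis by (rule that)
  qed
  define L where "L = {y \<in> ?B. fst (\<phi> y) = t * snd (\<phi> y)}"
  have "closed (?B \<inter> (\<lambda>y. fst (\<phi> y) - t * snd (\<phi> y)) -` {0})"
    by (intro continuous_closed_preimage continuous_intros cont) auto
  moreover have "?B \<inter> (\<lambda>y. fst (\<phi> y) - t * snd (\<phi> y)) -` {0} = L" by (auto simp: L_def)
  ultimately have "closed L" by (rule back_subst)
  have E_eq: "snd ` {x \<in> K. fst x = t * snd x} = (\<lambda>y. snd (\<phi> y)) ` L"
    unfolding K_eq L_def by auto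
  let ?E = "(\<lambda>y. snd (\<phi> y)) ` L"
  have contL: "continuous_on L (\<lambda>y. snd (\<phi> y))"
    by (intro continuous_intros continuous_on_subset[OF cont]) (auto simp: L_def)
  have LB: "L \<subseteq> ?B" by (auto simp: L_def)
  have cL: "compact L" using \<open>closed L\<close> LB by (meson bounded_cball bounded_subset compact_eq_bounded_closed)
  have injL: "inj_on (\<lambda>y. snd (\<phi> y)) L"
  proof (rule inj_onI)
    fix y z assume yz: "y \<in> L" "z \<in> L" "snd (\<phi> y) = snd (\<phi> z)"
    then have "\<phi> y = \<phi> z" by (intro prod_eqI) (auto simp: L_def)
    then show "y = z" using yz inj LB by (meson inj_onD subsetD)
  qed
  have cE: "compact ?E" by (rule compact_continuous_image[OF contL cL])
  have "connected (- ?E)"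
  proof (rule ccontr)
    assume "\<not> connected (- ?E)"
    \<comment> \<open>A closed set that separates has a component that separates; passing to it
      removes the ambiguity of the lift by multiples of 2 pi.\<close>
    then obtain C where C: "C \<in> components ?E" "\<not> connected (- C)"
      using separation_by_component_closed compact_imp_closed[OF cE] by metis
    have CE: "C \<subseteq> ?E" and conC: "connected C"
      using in_components_subset[OF C(1)] in_components_connected[OF C(1)] by auto
    have "closed C" using closed_components compact_imp_closed[OF cE] C(1) by blast
    then have cC: "compact C" using cE CE by (meson bounded_subset compact_eq_bounded_closed)
    define C' where "C' = L \<inter> (\<lambda>y. snd (\<phi> y)) -` C"
    have "closed C'" unfolding C'_def
      by (rule continuous_closed_preimage[OF contL \<open>closed L\<close> \<open>closed C\<close>])
    have C'L: "C' \<subseteq> L" by (auto simp: C'_def)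
    have cC': "compact C'" using \<open>closed C'\<close> cL C'L by (meson bounded_subset compact_eq_bounded_closed)
    have img: "(\<lambda>y. snd (\<phi> y)) ` C' = C" using CE by (auto simp: C'_def)
    have hom: "C' homeomorphic C"
      using homeomorphism_compact[OF cC' continuous_on_subset[OF contL C'L] img inj_on_subset[OF injL C'L]]
      unfolding homeomorphic_def by blast
    have conC': "connected C'" using homeomorphic_connectedness[OF hom] conC by blast
    have hC': "continuous_on C' h" using h(1) C'L LB by (meson continuous_on_subset subset_trans)
    \<comment> \<open>Distinct logarithms of \<open>t\<close> are at least 2 pi apart; the cruder
      gap 1 is enough for connectedness.\<close>
    have "h constant_on C'"
    proof (rule continuous_discrete_range_constant[OF conC' hC'])
      fix x assume x: "x \<in> C'"
      have e: "exp (h y) = t" if "y \<in> C'" for y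
      proof -
        have "y \<in> ?B" "fst (\<phi> y) = t * snd (\<phi> y)" using that C'L by (auto simp: L_def)
        then show ?thesis using h(2)[of y] nz[of y] by simp
      qed
      have "1 \<le> norm (h y - h x)" if y: "y \<in> C'" "h y \<noteq> h x" for y
      proof (rule ccontr)
        assume "\<not> 1 \<le> norm (h y - h x)"
        then have "\<bar>Im (h y) - Im (h x)\<bar> < 2 * pi"
          using abs_Im_le_cmod[of "h y - h x"] pi_gt3 by simp
        moreover have "exp (h y) = exp (h x)" using e[OF x] e[OF y(1)] by simp
        ultimately have "h y = h x" by (rule exp_complex_eqI)
        then show False using y(2) by blast
      qed
      then show "\<exists>e>0. \<forall>y. y \<in> C' \<and> h y \<noteq> h x \<longrightarrow> e \<le> norm (h y - h x)"
        by (intro exI[of _ 1]) simp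
    qed
    then obtain c where c: "\<And>y. y \<in> C' \<Longrightarrow> h y = c" unfolding constant_on_def by blast
    have "connected (- C')"
    proof (rule level_continuum_nonseparating[of ?B C' "\<lambda>y. Im (h y)" "Im c"])
      show "continuous_on ?B (\<lambda>y. Im (h y))" by (intro continuous_intros h)
      fix V x assume V: "open V" "x \<in> V" "V \<subseteq> ?B"
        and ext: "(\<forall>y\<in>V. Im (h y) \<le> Im (h x)) \<or> (\<forall>y\<in>V. Im (h x) \<le> Im (h y))"
      have VU: "V \<subseteq> U" using V(3) U(2) by blast
      show False
      proof (rule no_local_extremum_arg[OF N V(1) _ V(2) _ _ _ _ _ _ _ ext])
        show "\<phi> ` V \<subseteq> N" using VU U(3) by blast
        show "\<phi> ` V \<subseteq> Mcone" using V(3) K(2) K_eq by blast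
        show "continuous_on V D" by (rule continuous_on_subset[OF contD VU])
        show "continuous_on V h" by (rule continuous_on_subset[OF h(1) V(3)])
        show "inj_on \<phi> V" by (rule inj_on_subset[OF inj V(3)])
        show "(\<phi> has_derivative blinfun_apply (D y)) (at y)" if "y \<in> V" for y
          using der subsetD[OF VU that] .
        show "inj (blinfun_apply (D y))" if "y \<in> V" for y
          using injD subsetD[OF VU that] .
        show "fst (\<phi> y) / snd (\<phi> y) = exp (h y)" if "y \<in> V" for y
          using h(2) subsetD[OF V(3) that] .
      qed
    next
      show "C' \<subseteq> ?B" using C'L LB by (rule subset_trans)
      show "Im (h y) = Im c" if "y \<in> C'" for y using c[OF that] by simp
      show "closed C'" by fact
    qed simp_all
    then show False using nonseparating_homeomorphic[OF cC cC' hom] C(2) by blast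
  qed
  then show ?thesis unfolding E_eq .
qed

theorem theorem1p6:
  assumes "totally_real_disc K" and "K \<subseteq> Mcone"
  shows "poly_convex K \<longleftrightarrow> poly_hull K \<inter> {(z, w). z * w = 0} = {}"
proof
  assume "poly_convex K"
  then have hull: "poly_hull K = K" by (simp only: poly_convex_def)
  show "poly_hull K \<inter> {(z, w). z * w = 0} = {}"
    unfolding hull
  proof (rule equals0I)
    fix x assume x: "x \<in> K \<inter> {(z, w). z * w = 0}"
    then have "x \<in> Mcone" using assms(2) by blast
    then show False using MconeD(2,3)[of x] x by (simp add: case_prod_unfold)
  qed
next
  assume miss: "poly_hull K \<inter> {(z, w). z * w = 0} = {}"
  obtain \<phi> :: "real^2 \<Rightarrow> complex \<times> complex" and U D where
    U: "cball 0 1 \<subseteq> U" and der: "\<forall>x\<in>U. (\<phi> has_derivative blinfun_apply (D x)) (at x)"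
    and K: "K = \<phi> ` cball 0 1"
    using assms(1) unfolding totally_real_disc_def by blast
  have "continuous_on (cball 0 1) \<phi>"
  proof (rule continuous_at_imp_continuous_on, rule ballI)
    fix x :: "real^2" assume "x \<in> cball 0 1"
    then show "isCont \<phi> x" using der U has_derivative_continuous by blast
  qed
  then have "compact K" unfolding K by (rule compact_continuous_image[OF _ compact_cball])
  moreover have "K \<noteq> {}" unfolding K by simp
  ultimately show "poly_convex K"
    by (rule poly_convex_if_leaves_nonseparating[OF _ _ assms(2) miss leaf_nonseparating[OF assms]])
qed

end
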